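(* Let $q$ be an odd prime power, $r\ge 2$ an integer, and $a\in\mathrm{GF}(q^2)^*$, $b\in\mathrm{GF}(q^2)\setminus\mathrm{GF}(q)$ with $4a^{q+1}+(b^q-b)^2=0$. Let $\mathcal{B}(a,b)$ be the set of points $(x_1,\dots,x_r)$ of $\mathrm{AG}(r,q^2)$ satisfying \[x_r^q-x_r+a^q(x_1^{2q}+\dots+x_{r-1}^{2q})-a(x_1^2+\dots+x_{r-1}^2)=(b^q-b)(x_1^{q+1}+\dots+x_{r-1}^{q+1}),\] regarded as a set of points of $\mathrm{PG}(r,q^2)$ via $(x_1,\dots,x_r)\mapsto(1,x_1,\dots,x_r)$. Then the projective code $\mathcal{C}$ over $\mathrm{GF}(q^2)$ generated from $\mathcal{B}(a,b)$ has length $n=q^{2r-1}$, dimension $k=r+1$, and weight enumerator $w(x)=\sum_iA_ix^i$ with $A_0=1$, $A_{q^{2r-1}}=q^2-1$, and all remaining $A_i=0$ except: \begin{itemize} \item if $r\equiv 1\pmod 4$, or $r$ is odd and $q\equiv 1\pmod 4$: $A_{q^{2r-1}-q^{2r-3}-q^{3(r-1)/2}+q^{(3r-5)/2}}=q^{r+2}-q^r$, $A_{q^{2r-1}-q^{2r-3}}=q^{2r}-q^2+(q^{2r}-q^{r+1})(q^2-1)$, $A_{q^{2r-1}-q^{2r-3}+q^{(3r-5)/2}}=(q^{r+1}-q^r)(q^2-1)$; \item if $r\equiv 3\pmod 4$ and $q\equiv 3\pmod 4$: $A_{q^{2r-1}-q^{2r-3}-q^{(3r-5)/2}}=(q^{r+1}-q^r)(q^2-1)$,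 $A_{q^{2r-1}-q^{2r-3}}=q^{2r}-q^2+(q^{2r}-q^{r+1})(q^2-1)$, $A_{q^{2r-1}-q^{2r-3}+q^{3(r-1)/2}-q^{(3r-5)/2}}=q^{r+2}-q^r$; \item if $r$ is even: $A_{q^{2r-1}-q^{2r-3}+q^{(3r-4)/2}}=A_{q^{2r-1}-q^{2r-3}-q^{(3r-4)/2}}=\frac12(q^{r+1}-q^r)(q^2-1)$, $A_{q^{2r-1}-q^{2r-3}}=q^{2r}+q^{r+2}-q^r-q^2+(q^{2r}-q^{r+1})(q^2-1)$. \end{itemize} In particular, each of these codes has exactly $4$ non-zero weights.
   Context: The code generated from a set $\mathcal{V}$ of points of $\mathrm{PG}(r,q^2)$ (with respect to a fixed reference frame) is the linear code over $\mathrm{GF}(q^2)$ having as generator matrix the matrix whose columns are coordinate vectors of the points of $\mathcal{V}$; it is well defined up to monomial equivalence. $A_i$ denotes the number of codewords of Hamming weight $i$.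
   Formalization: For r=2 two listed weights both equal q^3 and A_{q^3} gets two values; the formal theorem adds the coinciding terms of w(x), and states exactly 3 non-zero weights for r=2 and exactly 4 for r≥3. *)

theory Defs
  imports
    "HOL-Number_Theory.Prime_Powers"
    "HOL-Computational_Algebra.Polynomial"
    "Jordan_Normal_Form.Matrix"
    "Jordan_Normal_Form.VS_Connect"
begin

text \<open>The subfield of order \<open>q\<close> of a field with \<open>q\<^sup>2\<close> elements, as the fixed points of
  \<open>x \<mapsto> x ^ q\<close>.\<close>

definition GF_sub :: "nat \<Rightarrow> 'a::{field,finite} set" where
  "GF_sub q = {x. x ^ q = x}"

text \<open>A point of \<open>PG(r, F)\<close> is a one-dimensional subspace of \<open>F ^ (r + 1)\<close>, given by a
  nonzero coordinate vector; the reference frame is the standard one.\<close>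

definition proj_point :: "'a::field vec \<Rightarrow> 'a vec set" where
  "proj_point v = {c \<cdot>\<^sub>v v | c. True}"

definition PG :: "nat \<Rightarrow> 'a::field vec set set" where
  "PG r = proj_point ` (carrier_vec (r + 1) - {0\<^sub>v (r + 1)})"

text \<open>The coordinates \<open>x\<^sub>1, \<dots>, x\<^sub>r\<close> of a point of \<open>AG(r, q\<^sup>2)\<close> are \<open>x $ 0, \<dots>, x $ (r - 1)\<close>.\<close>

definition B_affine :: "nat \<Rightarrow> nat \<Rightarrow> 'a::{field,finite} \<Rightarrow> 'a \<Rightarrow> 'a vec set" where
  "B_affine q r a b = {x \<in> carrier_vec r.
     (x $ (r - 1)) ^ q - x $ (r - 1)
       + a ^ q * (\<Sum>i<r - 1. (x $ i) ^ (2 * q)) - a * (\<Sum>i<r - 1. (x $ i) ^ 2)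
     = (b ^ q - b) * (\<Sum>i<r - 1. (x $ i) ^ (q + 1))}"

definition B_set :: "nat \<Rightarrow> nat \<Rightarrow> 'a::{field,finite} \<Rightarrow> 'a \<Rightarrow> 'a vec set set" where
  "B_set q r a b = (\<lambda>x. proj_point (vCons 1 x)) ` B_affine q r a b"

text \<open>\<open>generates_code r V n C\<close>: \<open>C\<close> is one of the monomially equivalent codes of length \<open>n\<close>
  generated from \<open>V \<subseteq> PG(r, F)\<close>. The columns of the generator matrix enumerate \<open>V\<close>, each point
  occurring exactly once; the order of the points and the scaling of their coordinate vectors
  are arbitrary.\<close>

definition generates_code :: "nat \<Rightarrow> 'a::field vec set set \<Rightarrow> nat \<Rightarrow> 'a vec set \<Rightarrow> bool" where
  "generates_code r V n C \<longleftrightarrow> V \<subseteq> PG r \<and>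
     (\<exists>G \<in> carrier_mat (r + 1) n.
        bij_betw (\<lambda>j. proj_point (col G j)) {..<n} V \<and> C = vec_space.row_space n G)"

definition code_dim :: "nat \<Rightarrow> 'a::field vec set \<Rightarrow> nat" where
  "code_dim n C = vectorspace.dim class_ring (module_vec TYPE('a) n \<lparr>carrier := C\<rparr>)"

definition hamming_weight :: "'a::zero vec \<Rightarrow> nat" where
  "hamming_weight c = card {j. j < dim_vec c \<and> c $ j \<noteq> 0}"

definition weight_count :: "'a::zero vec set \<Rightarrow> nat \<Rightarrow> nat" where
  "weight_count C i = card {c \<in> C. hamming_weight c = i}"

definition weight_enumerator :: "nat \<Rightarrow> 'a::zero vec set \<Rightarrow> int poly" where
  "weight_enumerator n C = (\<Sum>i\<le>n. monom (int (weight_count C i)) i)"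

lemma B_set_subset_PG: "B_set q r a b \<subseteq> PG r"
proof -
  have "vCons 1 x \<in> carrier_vec (r + 1) - {0\<^sub>v (r + 1)}" if "x \<in> B_affine q r a b" for x
  proof -
    have "x \<in> carrier_vec r" using that by (simp add: B_affine_def)
    moreover have "vCons 1 x \<noteq> 0\<^sub>v (r + 1)"
      by (metis add_gr_0 index_zero_vec(1) less_numeral_extra(1) vec_index_vCons_0 zero_neq_one)
    ultimately show ?thesis by simp
  qed
  then show ?thesis by (auto simp: B_set_def PG_def)
qed

lemma generates_code_exists:
  fixes V :: "'a::{field,finite} vec set set"
  assumes V: "V \<subseteq> PG r"
  shows "\<exists>C. generates_code r V (card V) C"
proof -
  have "finite (carrier_vec (r + 1) :: 'a vec set)"
  proof -
    have "(carrier_vec (r + 1) :: 'a vec set)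
      \<subseteq> vec_of_list ` {xs. set xs \<subseteq> UNIV \<and> length xs = r + 1}"
    proof
      fix v :: "'a vec" assume "v \<in> carrier_vec (r + 1)"
      then show "v \<in> vec_of_list ` {xs. set xs \<subseteq> UNIV \<and> length xs = r + 1}"
        by (intro image_eqI[where x = "list_of_vec v"]) (auto simp: vec_list)
    qed
    then show ?thesis using finite_lists_length_eq[OF finite_UNIV] finite_subset by blast
  qed
  then have "finite V" using V by (auto simp: PG_def intro: finite_subset)
  then obtain f where f: "bij_betw f {0..<card V} V" using ex_bij_betw_nat_finite by blast
  have "\<exists>v. v \<in> carrier_vec (r + 1) \<and> proj_point v = f j" if "j < card V" for j
    using that bij_betwE[OF f] V by (force simp: PG_def)
  then obtain v where v: "\<And>j. j < card V \<Longrightarrow> v j \<in> carrier_vec (r + 1) \<and> proj_point (v j) = f j"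
    by metis
  define G where "G = mat (r + 1) (card V) (\<lambda>(i, j). v j $ i)"
  have "col G j = v j" if "j < card V" for j
    using v[OF that] that by (intro eq_vecI) (auto simp: G_def)
  then have "bij_betw (\<lambda>j. proj_point (col G j)) {..<card V} V"
    using f v by (subst bij_betw_cong[where g = f]) (auto simp: lessThan_atLeast0)
  moreover have "G \<in> carrier_mat (r + 1) (card V)" by (simp add: G_def)
  ultimately show ?thesis using V by (auto simp: generates_code_def)
qed

end

theory Submission
  imports Defs "Jordan_Normal_Form.DL_Rank"
begin

text \<open>Let \<open>K = GF(q)\<close> and \<open>s = r - 1\<close>. The hypothesis \<open>4 * a ^ (q + 1) + (b ^ q - b) ^ 2 = 0\<close> says that
  the \<open>K\<close>-quadratic form \<open>h x = a ^ q * x ^ (2 * q) - a * x ^ 2 - (b ^ q - b) * x ^ (q + 1)\<close> on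
  \<open>GF(q\<^sup>2)\<close> has rank one: in a suitable \<open>K\<close>-basis \<open>e1\<close>, \<open>e2\<close> it is \<open>h (t * e1 + u * e2) = \<delta> * t ^ 2\<close>
  with \<open>\<delta> ^ q = - \<delta>\<close>, and the point set is \<open>y ^ q - y + (\<Sum>i<s. h (x i)) = 0\<close>.
  A hyperplane whose equation does not involve \<open>y\<close> contains none, \<open>q ^ (2 * s - 1)\<close> or all of its
  points. A hyperplane \<open>y = d + (\<Sum>i<s. m i * x i)\<close> cuts out an equation over \<open>K\<close> in the
  coordinates \<open>t i\<close>, \<open>u i\<close> of the \<open>x i\<close> that is linear in the \<open>u i\<close>: if some \<open>u i\<close> occurs, there are
  \<open>q ^ (2 * s - 1)\<close> solutions; otherwise completing squares leaves \<open>q ^ s\<close> times the number of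
  \<open>t \<in> K\<^sup>s\<close> with \<open>(\<Sum>i<s. t i ^ 2) = \<kappa>\<close>, where \<open>\<kappa>\<close> is equidistributed over \<open>K\<close>. These numbers
  follow by induction on \<open>s\<close> from the sum of the quadratic character over a hyperbola.\<close>

section \<open>The subfield of order \<open>q\<close> and its quadratic character\<close>

text \<open>Multiplication by a nonzero \<open>x\<close> permutes the nonzero elements; comparing
  their product before and after shows that \<open>x\<close> raised to their number is 1.\<close>

lemma finite_field_power_card:
  fixes x :: "'a::{field,finite}"
  shows "x ^ card (UNIV :: 'a set) = x"
proof (cases "x = 0")
  case False
  have "bij_betw ((*) x) (- {0}) (- {0})"
    by (rule bij_betw_byWitness[where f' = "\<lambda>y. y / x"]) (use False in auto)
  then have "(\<Prod>y\<in>- {0}. x * y) = \<Prod>(- {0})"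
    by (rule prod.reindex_bij_betw)
  then have "x ^ card (- {0 :: 'a}) * \<Prod>(- {0}) = 1 * \<Prod>(- {0})"
    by (simp add: prod.distrib)
  then have "x ^ card (- {0 :: 'a}) = 1"
    by (simp only: mult_cancel_right) auto
  moreover have "card (UNIV :: 'a set) = Suc (card (- {0 :: 'a}))"
    using finite_UNIV_card_ge_0[where 'a = 'a] by (simp add: Compl_eq_Diff_UNIV card_Diff_singleton)
  ultimately show ?thesis
    by simp
qed (simp add: finite_UNIV_card_ge_0)

section \<open>Frobenius and its fixed field \<open>K\<close>\<close>

locale GF_square =
  fixes q :: nat and TYP :: "'a::{field,finite} itself"
  assumes q_primepow: "primepow q" and q_odd: "odd q" and card_F: "card (UNIV :: 'a set) = q ^ 2"
begin

abbreviation K :: "'a set" where "K \<equiv> GF_sub q"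

lemma q_gt_2: "q > 2"
  using primepow_gt_Suc_0[OF q_primepow] q_odd by (cases "q = 2") auto

text \<open>Translation by 1 permutes the field, so adding 1 over all elements gives 0 and the
  characteristic divides \<open>q ^ 2\<close>. That \<open>q\<close> is a power of the
  characteristic makes \<open>x ^ q\<close> additive.\<close>

lemma CHAR_F: "prime CHAR('a)" "\<exists>k. q = CHAR('a) ^ k"
proof -
  obtain p k where pk: "prime p" "k > 0" "q = p ^ k"
    using q_primepow by (auto simp: primepow_def)
  show char: "prime CHAR('a)"
    using prime_CHAR_semidom[where 'a = 'a] finite_imp_CHAR_pos[where 'a = 'a] by simp
  have "bij_betw (\<lambda>x :: 'a. x + 1) UNIV UNIV"
    by (rule bij_betw_byWitness[where f' = "\<lambda>x. x - 1"]) auto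
  then have "(\<Sum>x\<in>UNIV. x + 1) = (\<Sum>x\<in>UNIV. x :: 'a)"
    by (rule sum.reindex_bij_betw)
  then have "of_nat (card (UNIV :: 'a set)) = (0 :: 'a)"
    by (simp add: sum.distrib)
  then have "CHAR('a) dvd p ^ (k * 2)"
    using pk(3) by (simp only: of_nat_eq_0_iff_char_dvd card_F power_mult)
  then have "CHAR('a) = p"
    using char pk(1) prime_dvd_power primes_dvd_imp_eq by blast
  then show "\<exists>k. q = CHAR('a) ^ k"
    using pk by blast
qed

lemma frob_add: "(x + y) ^ q = x ^ q + (y :: 'a) ^ q"
  using freshmans_dream'[OF CHAR_F(1)] CHAR_F(2) by blast

lemma frob_uminus: "(- x) ^ q = - ((x :: 'a) ^ q)"
  using q_odd by (rule power_minus_odd)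

lemma frob_diff: "(x - y) ^ q = x ^ q - (y :: 'a) ^ q"
  using frob_add[of x "- y"] frob_uminus[of y] by simp

lemma frob_sum: "(\<Sum>i\<in>I. f i) ^ q = (\<Sum>i\<in>I. (f i :: 'a) ^ q)"
  using freshmans_dream_sum'[OF CHAR_F(1)] CHAR_F(2) by blast

lemma frob_frob: "((x :: 'a) ^ q) ^ q = x"
  using finite_field_power_card[of x] by (simp add: card_F power_mult power2_eq_square)

lemma two_neq_0: "(2 :: 'a) \<noteq> 0"
proof
  assume "(2 :: 'a) = 0"
  then have "CHAR('a) dvd 2"
    using of_nat_eq_0_iff_char_dvd[where 'a = 'a, of 2] by simp
  then have "CHAR('a) = 2"
    using CHAR_F(1) primes_dvd_imp_eq two_is_prime_nat by blast
  then have "even q \<or> q = 1"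
    using CHAR_F(2) by (metis even_power even_numeral neq0_conv power_0)
  then show False
    using q_odd q_gt_2 by simp
qed

lemma four_neq_0: "(4 :: 'a) \<noteq> 0"
proof -
  have "(4 :: 'a) = 2 * 2" by simp
  then show ?thesis using two_neq_0 by (metis mult_eq_0_iff)
qed

lemma mem_K: "x \<in> K \<longleftrightarrow> x ^ q = x"
  by (simp add: GF_sub_def)

lemma K_0 [simp]: "0 \<in> K" and K_1 [simp]: "1 \<in> K"
  using q_gt_2 by (auto simp: mem_K)

lemma K_add [simp]: "x \<in> K \<Longrightarrow> y \<in> K \<Longrightarrow> x + y \<in> K"
  and K_diff [simp]: "x \<in> K \<Longrightarrow> y \<in> K \<Longrightarrow> x - y \<in> K"
  and K_uminus [simp]: "x \<in> K \<Longrightarrow> - x \<in> K"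
  and K_mult [simp]: "x \<in> K \<Longrightarrow> y \<in> K \<Longrightarrow> x * y \<in> K"
  and K_divide [simp]: "x \<in> K \<Longrightarrow> y \<in> K \<Longrightarrow> x / y \<in> K"
  by (auto simp: mem_K frob_add frob_diff frob_uminus power_mult_distrib power_divide)

lemma K_power [simp]: "x \<in> K \<Longrightarrow> x ^ n \<in> K"
  by (induction n) auto

lemma K_sum [simp]: "(\<And>i. i \<in> I \<Longrightarrow> f i \<in> K) \<Longrightarrow> sum f I \<in> K"
  by (simp add: mem_K frob_sum)

lemma K_2 [simp]: "2 \<in> K" and K_4 [simp]: "4 \<in> K"
  using K_add[of 1 1] K_add[of 2 2] K_add[OF K_1 K_1] by (simp_all del: K_add)

text \<open>Applied with \<open>c = 1\<close> to \<open>K\<close> and with \<open>c = - 1\<close> to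
  the elements that Frobenius negates; both are root sets of polynomials of degree
  \<open>q\<close>.\<close>

lemma card_frob_roots_le:
  "card {x :: 'a. x ^ q = c * x} \<le> q"
proof -
  let ?p = "Polynomial.monom 1 q + Polynomial.monom (- c) 1 :: 'a poly"
  have "poly.coeff ?p q = 1"
    using q_gt_2 by simp
  then have "?p \<noteq> 0"
    by (metis coeff_0 zero_neq_one)
  then have "card {x. poly ?p x = 0} \<le> degree ?p"
    by (rule card_poly_roots_bound)
  also have "\<dots> \<le> q"
    using q_gt_2 by (intro degree_add_le) (auto intro: order_trans[OF degree_monom_le])
  finally show ?thesis
    by (simp add: poly_monom)
qed

text \<open>The additive map \<open>x ^ q - x\<close> has kernel \<open>K\<close> and takes values
  among the elements negated by Frobenius. Kernel and image have at most \<open>q\<close> elements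
  each and their sizes multiply to \<open>q ^ 2\<close>, so both bounds are attained.\<close>

lemma card_K: "card K = q"
  and range_frob_minus_id: "range (\<lambda>x :: 'a. x ^ q - x) = {e. e ^ q = - e}"
proof -
  let ?g = "\<lambda>x :: 'a. x ^ q - x"
  have fiber: "card {x. ?g x = ?g x0} = card K" for x0
  proof (rule bij_betw_same_card[symmetric])
    show "bij_betw (\<lambda>k. x0 + k) K {x. ?g x = ?g x0}"
      by (rule bij_betw_byWitness[where f' = "\<lambda>x. x - x0"])
         (auto simp: mem_K frob_add frob_diff algebra_simps)
  qed
  have le: "card K \<le> q" "card {e :: 'a. e ^ q = - e} \<le> q"
    using card_frob_roots_le[of 1] card_frob_roots_le[of "- 1"] by (auto simp: GF_sub_def)
  have sub: "range ?g \<subseteq> {e. e ^ q = - e}"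
    by (auto simp: frob_diff frob_frob)
  have "q ^ 2 = (\<Sum>e\<in>range ?g. card {x. ?g x = e})"
    using sum.image_gen[of "UNIV :: 'a set" "\<lambda>_. 1 :: nat" ?g] by (simp flip: card_F)
  also have "\<dots> = (\<Sum>e\<in>range ?g. card K)"
    using fiber by (intro sum.cong) auto
  finally have prod: "q ^ 2 = card (range ?g) * card K"
    by simp
  have le': "card (range ?g) \<le> card {e :: 'a. e ^ q = - e}"
    using sub by (intro card_mono) auto
  have q0: "q > 0"
    using q_gt_2 by simp
  have "q * q \<le> q * card K"
    using mult_right_mono[of "card (range ?g)" q "card K"] prod le le'
    by (simp add: power2_eq_square)
  then show K: "card K = q"
    using le q0 by simp
  have "card (range ?g) = q"
    using prod q0 by (simp add: K power2_eq_square)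
  then have anti: "card {e :: 'a. e ^ q = - e} = q"
    using le le' by simp
  show "range ?g = {e. e ^ q = - e}"
    using sub anti \<open>card (range ?g) = q\<close> by (intro card_subset_eq) auto
qed

lemma card_frob_minus_id_fiber:
  assumes "(e :: 'a) ^ q = - e"
  shows "card {x. x ^ q - x = e} = q"
proof -
  obtain x0 where x0: "e = x0 ^ q - x0"
    using assms range_frob_minus_id by blast
  have "bij_betw (\<lambda>k. x0 + k) K {x. x ^ q - x = e}"
    by (rule bij_betw_byWitness[where f' = "\<lambda>x. x - x0"])
       (auto simp: x0 mem_K frob_add frob_diff algebra_simps)
  then show ?thesis
    using bij_betw_same_card card_K by metis
qed

text \<open>On \<open>K\<close> this is the quadratic character. Counting square roots minus one
  makes root counts and character sums interchangeable.\<close>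

definition eta :: "'a \<Rightarrow> int" where
  "eta z = int (card {t \<in> K. t ^ 2 = z}) - 1"

lemma eta_0 [simp]: "eta 0 = 0"
proof -
  have "{t \<in> K. t ^ 2 = 0} = {0}" by auto
  then show ?thesis by (simp add: eta_def)
qed

lemma eta_square:
  assumes "t \<in> K" "t \<noteq> 0"
  shows "eta (t ^ 2) = 1"
proof -
  have "{u \<in> K. u ^ 2 = t ^ 2} = {t, - t}"
    using assms by (auto simp: power2_eq_iff)
  moreover have "t \<noteq> - t"
    using assms two_neq_0 by (metis add.right_inverse mult_2 mult_eq_0_iff)
  ultimately show ?thesis
    by (simp add: eta_def)
qed

lemma eta_nonsquare: "\<not> (\<exists>t\<in>K. t ^ 2 = z) \<Longrightarrow> eta z = - 1"
  by (auto simp: eta_def)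

lemma eta_cases:
  assumes "z \<noteq> 0"
  obtains t where "t \<in> K" "t \<noteq> 0" "z = t ^ 2" "eta z = 1"
  | "\<not> (\<exists>t\<in>K. t ^ 2 = z)" "eta z = - 1"
proof (cases "\<exists>t\<in>K. t ^ 2 = z")
  case True
  then obtain t where "t \<in> K" "t ^ 2 = z" by blast
  then show ?thesis
    using that(1)[of t] eta_square[of t] assms by auto
qed (use that(2) eta_nonsquare in blast)

text \<open>Sorts the \<open>t\<close> by their square, since \<open>z\<close> has
  \<open>1 + eta z\<close> roots; this trades sums over squares for character sums.\<close>

lemma sum_squares:
  fixes f :: "'a \<Rightarrow> int"
  shows "(\<Sum>t\<in>K. f (t ^ 2)) = (\<Sum>z\<in>K. (1 + eta z) * f z)"
proof -
  have "(\<Sum>t\<in>K. f (t ^ 2)) = (\<Sum>z\<in>K. of_nat (card {t \<in> K. t ^ 2 = z}) * f z)"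
    by (rule sum_fun_comp) auto
  then show ?thesis by (simp add: eta_def)
qed

lemma sum_eta: "(\<Sum>z\<in>K. eta z) = 0"
  using sum_squares[of "\<lambda>_. 1"] by (simp add: sum.distrib)

lemma bij_uminus_K: "bij_betw uminus K K"
  by (rule bij_betw_byWitness[where f' = uminus]) auto

lemma bij_diff_K: "c \<in> K \<Longrightarrow> bij_betw (\<lambda>x. c - x) K K"
  by (rule bij_betw_byWitness[where f' = "\<lambda>x. c - x"]) auto

text \<open>The only instance of multiplicativity required. If \<open>- 1\<close> is the square of
  \<open>i\<close>, multiplication by \<open>i\<close> matches the roots of \<open>z\<close> and
  \<open>- z\<close>. Otherwise \<open>z\<close> and \<open>- z\<close> are never both nonzero
  squares, so \<open>eta z + eta (- z)\<close> is never positive; its sum over \<open>K\<close> is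
  0, hence it vanishes everywhere.\<close>

lemma eta_uminus:
  assumes "z \<in> K"
  shows "eta (- z) = eta (- 1) * eta z"
proof (cases "\<exists>i\<in>K. i ^ 2 = - 1")
  case True
  then obtain i where i: "i \<in> K" "i ^ 2 = - 1" by blast
  then have "i \<noteq> 0" by auto
  have "bij_betw (\<lambda>t. i * t) {t \<in> K. t ^ 2 = z} {t \<in> K. t ^ 2 = - z}"
    by (rule bij_betw_byWitness[where f' = "\<lambda>t. t / i"])
       (use i \<open>i \<noteq> 0\<close> in \<open>auto simp: power_mult_distrib power_divide\<close>)
  then have "eta (- z) = eta z"
    using bij_betw_same_card by (fastforce simp: eta_def)
  moreover have "eta (- 1) = 1"
    using eta_square[OF i(1) \<open>i \<noteq> 0\<close>] i(2) by simp
  ultimately show ?thesis by simp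
next
  case False
  then have chi: "eta (- 1) = - 1"
    by (rule eta_nonsquare)
  have nonpos: "eta z + eta (- z) \<le> 0" for z
  proof (cases "z = 0")
    case False
    have no: "\<not> (\<exists>t\<in>K. \<exists>u\<in>K. t ^ 2 = z \<and> u ^ 2 = - z)"
    proof safe
      fix t u assume "t \<in> K" "u \<in> K" "z = t ^ 2" "u ^ 2 = - (t ^ 2)"
      then have "u / t \<in> K" "(u / t) ^ 2 = - 1"
        using \<open>z \<noteq> 0\<close> by (auto simp: power_divide)
      then show False
        using \<open>\<not> (\<exists>i\<in>K. i ^ 2 = - 1)\<close> by blast
    qed
    show ?thesis
    proof -
      have "- z \<noteq> 0" using False by simp
      show ?thesis
        by (rule eta_cases[OF False]; rule eta_cases[OF \<open>- z \<noteq> 0\<close>]) (use no in auto)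
    qed
  qed simp
  have "(\<Sum>z\<in>K. eta (- z)) = (\<Sum>z\<in>K. eta z)"
    by (rule sum.reindex_bij_betw[OF bij_uminus_K])
  then have "(\<Sum>z\<in>K. - (eta z + eta (- z))) = 0"
    by (simp add: sum_negf sum_eta sum.distrib sum_subtractf)
  then have "- (eta z + eta (- z)) = 0"
  proof (rule sum_nonneg_eq_0_iff[THEN iffD1, rule_format, rotated 2])
    show "0 \<le> - (eta x + eta (- x))" for x
      using nonpos[of x] by simp
  qed (use assms in auto)
  then show ?thesis by (simp add: chi)
qed

text \<open>The solutions of \<open>u\<^sup>2 = t\<^sup>2 - \<kappa>\<close> form a hyperbola, parametrised by \<open>v = t - u\<close>.\<close>

lemma sum_eta_hyperbola:
  assumes "\<kappa> \<in> K" "\<kappa> \<noteq> 0"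
  shows "(\<Sum>t\<in>K. eta (t ^ 2 - \<kappa>)) = - 1"
proof -
  let ?H = "SIGMA t:K. {u \<in> K. u ^ 2 = t ^ 2 - \<kappa>}"
  have v: "t - u \<noteq> 0 \<and> \<kappa> / (t - u) = t + u" if "u ^ 2 = t ^ 2 - \<kappa>" for t u
  proof -
    have *: "(t + u) * (t - u) = \<kappa>"
      using that by (simp add: power2_eq_square algebra_simps)
    then have "t - u \<noteq> 0"
      using assms by auto
    then show ?thesis
      using * by (simp add: divide_eq_eq)
  qed
  have half: "(x + x) / 2 = x" for x :: 'a
    using two_neq_0 by (metis mult_2 nonzero_mult_div_cancel_left)
  \<comment> \<open>The product \<open>(t + u) * (t - u) = \<kappa>\<close> forces
    \<open>t + u = \<kappa> / v\<close>; halving sum and difference recovers \<open>t\<close> and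
    \<open>u\<close>.\<close>
  have "bij_betw (\<lambda>(t, u). t - u) ?H (K - {0})"
  proof (rule bij_betw_byWitness[where f' = "\<lambda>v. ((\<kappa> / v + v) / 2, (\<kappa> / v - v) / 2)"])
    show "\<forall>p\<in>?H. (\<lambda>v. ((\<kappa> / v + v) / 2, (\<kappa> / v - v) / 2)) ((\<lambda>(t, u). t - u) p) = p"
      using half by (auto simp: v simp del: diff_eq_diff_eq)
    show "\<forall>w\<in>K - {0}. (\<lambda>(t, u). t - u) ((\<kappa> / w + w) / 2, (\<kappa> / w - w) / 2) = w"
      using half by (auto simp flip: diff_divide_distrib)
    show "(\<lambda>(t, u). t - u) ` ?H \<subseteq> K - {0}"
      using v by auto
    have "((\<kappa> / w - w) / 2) ^ 2 = ((\<kappa> / w + w) / 2) ^ 2 - \<kappa>" if "w \<noteq> 0" for w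
      using that two_neq_0 four_neq_0 by (simp add: field_simps power2_eq_square)
    then show "(\<lambda>v. ((\<kappa> / v + v) / 2, (\<kappa> / v - v) / 2)) ` (K - {0}) \<subseteq> ?H"
      using assms by auto
  qed
  then have "card ?H = q - 1"
    by (simp add: bij_betw_same_card card_K)
  \<comment> \<open>Over each \<open>t\<close> the hyperbola has
    \<open>1 + eta (t ^ 2 - \<kappa>)\<close> points, so the character sum is the number of points
    minus \<open>q\<close>.\<close>
  then have "(\<Sum>t\<in>K. card {u \<in> K. u ^ 2 = t ^ 2 - \<kappa>}) = q - 1"
    by (simp add: card_SigmaI)
  then have "(\<Sum>t\<in>K. int (card {u \<in> K. u ^ 2 = t ^ 2 - \<kappa>})) = int q - 1"
    using q_gt_2 by (simp flip: of_nat_sum)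
  then show ?thesis
    by (simp add: eta_def sum_subtractf card_K)
qed

text \<open>The factor \<open>eta (- 1)\<close> comes from reversing the sign of
  \<open>t ^ 2 - \<kappa>\<close>. For \<open>\<kappa> = 0\<close> the hyperbola degenerates: every
  nonzero \<open>t\<close> contributes 1, which explains the extra \<open>q\<close>.\<close>

lemma sum_eta_shift:
  assumes "\<kappa> \<in> K"
  shows "(\<Sum>t\<in>K. eta (\<kappa> - t ^ 2)) = eta (- 1) * (int q * of_bool (\<kappa> = 0) - 1)"
proof -
  have "(\<Sum>t\<in>K. eta (\<kappa> - t ^ 2)) = eta (- 1) * (\<Sum>t\<in>K. eta (t ^ 2 - \<kappa>))"
    unfolding sum_distrib_left
    using eta_uminus[of "t ^ 2 - \<kappa>" for t] assms by (intro sum.cong) auto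
  also have "(\<Sum>t\<in>K. eta (t ^ 2 - \<kappa>)) = int q * of_bool (\<kappa> = 0) - 1"
  proof (cases "\<kappa> = 0")
    case True
    have "(\<Sum>t\<in>K. eta (t ^ 2)) = (\<Sum>t\<in>K. 1 - of_bool (t = 0))"
      by (intro sum.cong) (auto simp: eta_square)
    also have "\<dots> = int q - 1"
      by (simp add: sum_subtractf card_K of_bool_def sum.delta)
    finally show ?thesis using True by simp
  qed (use sum_eta_hyperbola assms in simp)
  finally show ?thesis .
qed

text \<open>The companion of \<open>sum_eta_shift\<close> for the passage from an even to an odd
  number of squares: only \<open>z = \<kappa>\<close> meets the indicator, and the numbers of roots
  \<open>1 + eta z\<close> sum to \<open>q\<close>.\<close>

lemma sum_of_bool_square:
  assumes "\<kappa> \<in> K"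
  shows "(\<Sum>t\<in>K. int q * of_bool (\<kappa> - t ^ 2 = 0) - 1) = int q * eta \<kappa>"
proof -
  have "(\<Sum>t\<in>K. int q * of_bool (\<kappa> - t ^ 2 = 0) - 1)
      = (\<Sum>z\<in>K. (1 + eta z) * (int q * of_bool (\<kappa> - z = 0) - 1))"
    by (rule sum_squares)
  also have "\<dots> = (\<Sum>z\<in>K. int q * (if \<kappa> = z then 1 + eta z else 0) - (1 + eta z))"
    by (intro sum.cong) (auto simp: algebra_simps)
  also have "\<dots> = int q * (1 + eta \<kappa>) - int q"
    using assms by (simp add: sum_subtractf sum.distrib sum_eta card_K flip: sum_distrib_left)
  finally show ?thesis by (simp add: algebra_simps)
qed

lemma chi_q_mod_4: "eta (- 1) = (if q mod 4 = 1 then 1 else - 1)"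
proof -
  have pow: "x ^ (q - 1) = 1" if "x \<in> K" "x \<noteq> 0" for x
  proof -
    have "x ^ (q - 1) * x = 1 * x"
      using that q_gt_2 by (simp add: mem_K flip: power_Suc2)
    then show ?thesis
      using that by simp
  qed
  show ?thesis
  proof (cases "q mod 4 = 1")
    case True
    then obtain m where m: "q = 4 * m + 1"
      by (metis mult_div_mod_eq)
    \<comment> \<open>A polynomial of degree \<open>2 * m\<close> cannot vanish on all
      \<open>4 * m\<close> nonzero elements of \<open>K\<close>. For such an \<open>x\<close> the
      power \<open>x ^ (2 * m)\<close> is a square root of 1 other than 1, so \<open>x ^ m\<close>
      is a square root of \<open>- 1\<close>.\<close>
    have "\<exists>x\<in>K. x \<noteq> 0 \<and> x ^ (2 * m) \<noteq> 1"
    proof (rule ccontr)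
      assume no: "\<not> ?thesis"
      let ?p = "Polynomial.monom 1 (2 * m) - 1 :: 'a poly"
      have "m > 0" using q_gt_2 m by (cases m) auto
      then have "poly.coeff ?p (2 * m) = 1"
        by simp
      then have p0: "?p \<noteq> 0"
        by (metis coeff_0 zero_neq_one)
      have "K - {0} \<subseteq> {x. poly ?p x = 0}"
        using no by (auto simp: poly_monom)
      then have "card (K - {0}) \<le> card {x. poly ?p x = 0}"
        by (intro card_mono) auto
      also have "\<dots> \<le> degree ?p"
        using p0 by (rule card_poly_roots_bound)
      also have "\<dots> \<le> 2 * m"
        by (intro degree_diff_le) (auto intro: degree_monom_le)
      finally show False
        using \<open>m > 0\<close> card_Diff_singleton[OF K_0] m unfolding card_K by linarith
    qed
    then obtain x where x: "x \<in> K" "x \<noteq> 0" "x ^ (2 * m) \<noteq> 1"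
      by blast
    have "2 * m * 2 = q - 1"
      by (simp add: m)
    then have "(x ^ (2 * m)) ^ 2 = 1"
      using pow[OF x(1,2)] power_mult[of x "2 * m" 2] by argo
    then have "x ^ (m * 2) = - 1"
      using x(3) by (simp add: power2_eq_1_iff mult.commute)
    then have "(x ^ m) ^ 2 = - 1"
      by (simp add: power_mult)
    then show ?thesis
      using eta_square[of "x ^ m"] x True by simp
  next
    case False
    then have "q mod 4 = 3"
      using q_odd by presburger
    then obtain m where m: "q = 4 * m + 3"
      by (metis mult_div_mod_eq)
    have "\<not> (\<exists>t\<in>K. t ^ 2 = - 1)"
    proof safe
      fix t assume t: "t \<in> K" "t ^ 2 = - 1"
      \<comment> \<open>Here \<open>q - 1\<close> is twice an odd number, so
        \<open>t ^ (q - 1) = 1\<close> becomes an odd power of \<open>- 1\<close>.\<close>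
      then have "1 = t ^ (2 * (2 * m + 1))"
      proof -
        have "2 * (2 * m + 1) = q - 1" by (simp add: m)
        moreover have "t \<noteq> 0" using t by auto
        ultimately show ?thesis using pow[OF t(1)] by argo
      qed
      also have "\<dots> = - 1"
        unfolding power_mult t(2) by simp
      finally show False
        using two_neq_0 by (simp add: eq_neg_iff_add_eq_0)
    qed
    then show ?thesis
      using False eta_nonsquare by simp
  qed
qed

end

section \<open>Sums of squares\<close>

lemma bij_betw_PiE_insert:
  assumes "i \<notin> S"
  shows "bij_betw (\<lambda>(y, f). f(i := y)) (A i \<times> Pi\<^sub>E S A) (Pi\<^sub>E (insert i S) A)"
  unfolding bij_betw_def
  using inj_combinator[OF assms, of A] PiE_insert_eq[of i S A] by simp

lemma card_filter_bij_betw: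
  assumes "bij_betw h X Y" and "\<And>x. x \<in> X \<Longrightarrow> P x \<longleftrightarrow> Q (h x)"
  shows "card {x \<in> X. P x} = card {y \<in> Y. Q y}"
proof -
  have "bij_betw h {x \<in> X. P x} {y \<in> Y. Q y}"
    using assms unfolding bij_betw_def by (auto intro: inj_on_subset)
  then show ?thesis by (rule bij_betw_same_card)
qed

lemma card_filter_Times:
  assumes "finite X" "finite Y"
  shows "card {p \<in> X \<times> Y. P (fst p) (snd p)} = (\<Sum>x\<in>X. card {y \<in> Y. P x y})"
proof -
  have "{p \<in> X \<times> Y. P (fst p) (snd p)} = (SIGMA x:X. {y \<in> Y. P x y})" by auto
  then show ?thesis using assms by simp
qed

text \<open>Solving for the coordinate with nonzero coefficient leaves the others free. The premise
  \<open>solv\<close> keeps the solution inside \<open>A\<close>, so that the lemma covers both the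
  subfield and the whole field.\<close>

lemma card_linear_eq:
  fixes \<mu> :: "'i \<Rightarrow> 'a::field"
  assumes "finite S" "i \<in> S" "\<mu> i \<noteq> 0" "finite A"
    and solv: "\<And>u. u \<in> S - {i} \<rightarrow>\<^sub>E A \<Longrightarrow> (\<kappa> - (\<Sum>j\<in>S - {i}. \<mu> j * u j)) / \<mu> i \<in> A"
  shows "card {u \<in> S \<rightarrow>\<^sub>E A. (\<Sum>j\<in>S. \<mu> j * u j) = \<kappa>} = card A ^ (card S - 1)"
proof -
  have S: "S = insert i (S - {i})" using assms by auto
  let ?sol = "\<lambda>u. (\<kappa> - (\<Sum>j\<in>S - {i}. \<mu> j * u j)) / \<mu> i"
  have "card {u \<in> S \<rightarrow>\<^sub>E A. (\<Sum>j\<in>S. \<mu> j * u j) = \<kappa>}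
      = card {p \<in> A \<times> (S - {i} \<rightarrow>\<^sub>E A). fst p = ?sol (snd p)}"
  proof (rule card_filter_bij_betw[symmetric])
    show "bij_betw (\<lambda>(y, f). f(i := y)) (A \<times> (S - {i} \<rightarrow>\<^sub>E A)) (S \<rightarrow>\<^sub>E A)"
      using bij_betw_PiE_insert[of i "S - {i}" "\<lambda>_. A"] S by simp
    fix p assume "p \<in> A \<times> (S - {i} \<rightarrow>\<^sub>E A)"
    obtain y u where p: "p = (y, u)" by fastforce
    have "(\<Sum>j\<in>S. \<mu> j * (u(i := y)) j) = \<mu> i * y + (\<Sum>j\<in>S - {i}. \<mu> j * u j)"
      using assms by (subst sum.remove[of S i]) auto
    then show "fst p = ?sol (snd p) \<longleftrightarrow> (\<Sum>j\<in>S. \<mu> j * (case p of (y, f) \<Rightarrow> f(i := y)) j) = \<kappa>"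
      using assms by (auto simp: p field_simps)
  qed
  also have "{p \<in> A \<times> (S - {i} \<rightarrow>\<^sub>E A). fst p = ?sol (snd p)} = (\<lambda>u. (?sol u, u)) ` (S - {i} \<rightarrow>\<^sub>E A)"
    using solv by auto
  also have "card \<dots> = card (S - {i} \<rightarrow>\<^sub>E A)"
    by (rule card_image) (auto intro: inj_onI)
  also have "\<dots> = card A ^ (card S - 1)"
    using assms by (simp add: card_funcsetE)
  finally show ?thesis .
qed

text \<open>Splits tuples over the big field into pairs of tuples over \<open>K\<close>; it serves
  both the points \<open>x i\<close> and the coefficients \<open>m i\<close>.\<close>

lemma bij_betw_PiE_pair:
  assumes "bij_betw \<psi> (B \<times> C) A"
  shows "bij_betw (\<lambda>(t, u). \<lambda>i\<in>S. \<psi> (t i, u i)) ((S \<rightarrow>\<^sub>E B) \<times> (S \<rightarrow>\<^sub>E C)) (S \<rightarrow>\<^sub>E A)"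
proof -
  let ?\<phi> = "inv_into (B \<times> C) \<psi>"
  have 1: "?\<phi> (\<psi> (x, y)) = (x, y)" if "x \<in> B" "y \<in> C" for x y
    using that bij_betw_inv_into_left[OF assms] by simp
  have 2: "\<psi> (?\<phi> x) = x" "fst (?\<phi> x) \<in> B" "snd (?\<phi> x) \<in> C" if "x \<in> A" for x
    using that bij_betw_inv_into_right[OF assms] bij_betw_apply[OF bij_betw_inv_into[OF assms], of x]
    by (auto simp: mem_Times_iff)
  have 3: "\<psi> (x, y) \<in> A" if "x \<in> B" "y \<in> C" for x y
    using that bij_betw_apply[OF assms] by simp
  show ?thesis
    by (rule bij_betw_byWitness[where f' = "\<lambda>f. (\<lambda>i\<in>S. fst (?\<phi> (f i)), \<lambda>i\<in>S. snd (?\<phi> (f i)))"])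
       (auto simp: 1 2 3 PiE_iff extensional_def fun_eq_iff)
qed

context GF_square
begin

definition nrep :: "nat \<Rightarrow> 'a \<Rightarrow> nat" where
  "nrep s \<kappa> = card {t \<in> {..<s} \<rightarrow>\<^sub>E K. (\<Sum>i<s. t i ^ 2) = \<kappa>}"

lemma nrep_0: "nrep 0 \<kappa> = of_bool (\<kappa> = 0)"
  by (auto simp: nrep_def)

lemma nrep_Suc: "nrep (Suc s) \<kappa> = (\<Sum>z\<in>K. nrep s (\<kappa> - z ^ 2))"
proof -
  have "nrep (Suc s) \<kappa>
      = card {p \<in> K \<times> ({..<s} \<rightarrow>\<^sub>E K). (\<Sum>i<s. snd p i ^ 2) = \<kappa> - fst p ^ 2}"
    unfolding nrep_def
  proof (rule card_filter_bij_betw[symmetric])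
    show "bij_betw (\<lambda>(y, f). f(s := y)) (K \<times> ({..<s} \<rightarrow>\<^sub>E K)) ({..<Suc s} \<rightarrow>\<^sub>E K)"
      using bij_betw_PiE_insert[of s "{..<s}" "\<lambda>_. K"] by (simp add: lessThan_Suc)
    fix p assume "p \<in> K \<times> ({..<s} \<rightarrow>\<^sub>E K)"
    obtain z t where p: "p = (z, t)" by fastforce
    have "(\<Sum>i<Suc s. (t(s := z)) i ^ 2) = (\<Sum>i<s. t i ^ 2) + z ^ 2"
      by simp
    then show "(\<Sum>i<s. snd p i ^ 2) = \<kappa> - fst p ^ 2
        \<longleftrightarrow> (\<Sum>i<Suc s. (case p of (y, f) \<Rightarrow> f(s := y)) i ^ 2) = \<kappa>"
      by (simp only: p prod.case fst_conv snd_conv eq_diff_eq)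
  qed
  also have "\<dots> = (\<Sum>z\<in>K. nrep s (\<kappa> - z ^ 2))"
    unfolding nrep_def by (rule card_filter_Times) (simp_all add: finite_PiE)
  finally show ?thesis .
qed

text \<open>Summing over the last coordinate leads from odd to even length by
  \<open>sum_eta_shift\<close> and from even to odd by \<open>sum_of_bool_square\<close>. Two such
  steps multiply the error term by \<open>eta (- 1) * int q\<close>.\<close>

lemma nrep_odd_even:
  assumes "\<kappa> \<in> K"
  shows "int (nrep (2 * k + 1) \<kappa>) = int q ^ (2 * k) + (eta (- 1) * int q) ^ k * eta \<kappa>"
    and "int (nrep (2 * k + 2) \<kappa>) = int q ^ (2 * k + 1)
      + (eta (- 1) * int q) ^ k * eta (- 1) * (int q * of_bool (\<kappa> = 0) - 1)"
proof -
  \<comment> \<open>Conditional on the odd formula for the same \<open>k\<close>, so that it can be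
    used inside the induction as well as for the second claim.\<close>
  have even: "int (nrep (2 * k + 2) \<kappa>) = int q ^ (2 * k + 1)
      + (eta (- 1) * int q) ^ k * eta (- 1) * (int q * of_bool (\<kappa> = 0) - 1)"
    if "\<And>\<kappa>. \<kappa> \<in> K \<Longrightarrow> int (nrep (2 * k + 1) \<kappa>) = int q ^ (2 * k) + (eta (- 1) * int q) ^ k * eta \<kappa>"
      and "\<kappa> \<in> K" for k \<kappa>
  proof -
    have "int (nrep (2 * k + 2) \<kappa>) = (\<Sum>z\<in>K. int (nrep (2 * k + 1) (\<kappa> - z ^ 2)))"
      using nrep_Suc[of "2 * k + 1" \<kappa>] by simp
    also have "\<dots> = int q ^ (2 * k + 1) + (eta (- 1) * int q) ^ k * (\<Sum>z\<in>K. eta (\<kappa> - z ^ 2))"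
      using that by (simp add: sum.distrib card_K flip: sum_distrib_left)
    finally show ?thesis
      using that(2) by (simp add: sum_eta_shift)
  qed
  have odd: "int (nrep (2 * k + 1) \<kappa>) = int q ^ (2 * k) + (eta (- 1) * int q) ^ k * eta \<kappa>"
    if "\<kappa> \<in> K" for k \<kappa>
    using that
  proof (induction k arbitrary: \<kappa>)
    case 0
    have "int (nrep (Suc 0) \<kappa>) = (\<Sum>z\<in>K. of_bool (\<kappa> - z ^ 2 = 0))"
      by (simp add: nrep_Suc nrep_0)
    also have "\<dots> = (\<Sum>z\<in>K. (1 + eta z) * of_bool (\<kappa> - z = 0))"
      by (rule sum_squares)
    also have "\<dots> = (\<Sum>z\<in>K. if \<kappa> = z then 1 + eta z else 0)"
      by (intro sum.cong) auto
    also have "\<dots> = 1 + eta \<kappa>"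
      using 0 by simp
    finally show ?case by simp
  next
    case (Suc k)
    let ?c = "(eta (- 1) * int q) ^ k * eta (- 1)"
    have "int (nrep (2 * Suc k + 1) \<kappa>) = (\<Sum>z\<in>K. int (nrep (2 * k + 2) (\<kappa> - z ^ 2)))"
      using nrep_Suc[of "2 * k + 2" \<kappa>] by simp
    also have "\<dots> = (\<Sum>z\<in>K. int q ^ (2 * k + 1) + ?c * (int q * of_bool (\<kappa> - z ^ 2 = 0) - 1))"
      using even[OF Suc.IH] Suc.prems by (intro sum.cong) auto
    also have "\<dots> = int q ^ (2 * k + 2) + ?c * (\<Sum>z\<in>K. int q * of_bool (\<kappa> - z ^ 2 = 0) - 1)"
      by (simp add: sum.distrib card_K sum_distrib_left)
    also have "(\<Sum>z\<in>K. int q * of_bool (\<kappa> - z ^ 2 = 0) - 1) = int q * eta \<kappa>"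
      using Suc.prems by (rule sum_of_bool_square)
    finally show ?case by (simp add: mult_ac)
  qed
  show "int (nrep (2 * k + 1) \<kappa>) = int q ^ (2 * k) + (eta (- 1) * int q) ^ k * eta \<kappa>"
    using assms by (rule odd)
  show "int (nrep (2 * k + 2) \<kappa>) = int q ^ (2 * k + 1)
      + (eta (- 1) * int q) ^ k * eta (- 1) * (int q * of_bool (\<kappa> = 0) - 1)"
    using assms by (intro even odd) auto
qed

end

section \<open>The rank one form\<close>

locale quasi_hermitian = GF_square q TYP
  for q :: nat and TYP :: "'a::{field,finite} itself" +
  fixes a b :: 'a
  assumes a_neq_0: "a \<noteq> 0" and b_notin: "b \<notin> GF_sub q"
    and discr: "4 * a ^ (q + 1) + (b ^ q - b) ^ 2 = 0"
begin

definition h :: "'a \<Rightarrow> 'a" where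
  "h x = a ^ q * x ^ (2 * q) - a * x ^ 2 - (b ^ q - b) * x ^ (q + 1)"

text \<open>Recording \<open>e1 = e2 * b\<close> reduces linear independence over \<open>K\<close>
  to the hypothesis that \<open>b\<close> lies outside \<open>K\<close>.\<close>

definition basis_like :: "'a \<Rightarrow> 'a \<Rightarrow> 'a \<Rightarrow> bool" where
  "basis_like e1 e2 \<delta> \<longleftrightarrow> \<delta> \<noteq> 0 \<and> \<delta> ^ q = - \<delta> \<and> e2 \<noteq> 0 \<and> e1 = e2 * b \<and>
     (\<forall>t\<in>K. \<forall>u\<in>K. h (t * e1 + u * e2) = \<delta> * t ^ 2)"

text \<open>By the hypothesis on \<open>a\<close> and \<open>b\<close> the form factors as \<open>h x = a ^ q * (x ^ q - \<gamma> * x) ^ 2\<close> with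
  \<open>\<gamma> ^ (q + 1) = 1\<close>; the vector \<open>e2\<close> below spans its radical (Hilbert 90).\<close>

lemma basis_exists: "\<exists>e1 e2 \<delta>. basis_like e1 e2 \<delta>"
proof -
  define \<beta> where "\<beta> = b ^ q - b"
  define \<gamma> where "\<gamma> = \<beta> / (2 * a ^ q)"
  have \<beta>q: "\<beta> ^ q = - \<beta>" and \<beta>0: "\<beta> \<noteq> 0"
    using b_notin by (auto simp: \<beta>_def frob_diff frob_frob mem_K)
  have d: "\<beta> * \<beta> = - (4 * (a ^ q * a))"
    using discr by (simp add: \<beta>_def power2_eq_square eq_neg_iff_add_eq_0 add.commute mult.commute)
  have two: "(2 :: 'a) ^ q = 2"
    using K_2 by (simp add: mem_K)
  have aq: "a ^ q \<noteq> 0"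
    using a_neq_0 by simp
  \<comment> \<open>The mixed term of the square dictates \<gamma>; the hypothesis on
    \<open>a\<close> and \<open>b\<close> says exactly that its \<open>x ^ 2\<close> term then fits
    too.\<close>
  have \<gamma>2: "a ^ q * \<gamma> ^ 2 = - a"
  proof -
    have "a ^ q * \<gamma> ^ 2 = \<beta> * \<beta> / (4 * a ^ q)"
      using a_neq_0 two_neq_0 four_neq_0 by (simp add: \<gamma>_def field_simps power2_eq_square)
    then show ?thesis
      using aq four_neq_0 by (simp add: d)
  qed
  have h_eq: "h x = a ^ q * (x ^ q * x ^ q) - a * (x * x) - \<beta> * (x ^ q * x)" for x
    by (simp add: h_def \<beta>_def mult_2 power_add power2_eq_square mult.commute[of x "x ^ q"])
  have hx: "h x = a ^ q * (x ^ q - \<gamma> * x) ^ 2" for x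
  proof -
    have "2 * a ^ q * \<gamma> = \<beta>"
      using a_neq_0 two_neq_0 by (simp add: \<gamma>_def)
    then have "h x = a ^ q * (x ^ q * x ^ q) + (a ^ q * \<gamma> ^ 2) * x ^ 2 - (2 * a ^ q * \<gamma>) * (x ^ q * x)"
      by (simp only: h_eq \<gamma>2) (simp add: power2_eq_square)
    also have "\<dots> = a ^ q * (x ^ q - \<gamma> * x) ^ 2"
      by (simp only: power2_eq_square) (simp add: algebra_simps)
    finally show ?thesis .
  qed
  have \<gamma>q: "\<gamma> ^ q * \<gamma> = 1"
  proof -
    have "\<gamma> ^ q = - \<beta> / (2 * a)"
      by (simp only: \<gamma>_def power_divide power_mult_distrib frob_frob two \<beta>q)
    then have "\<gamma> ^ q * \<gamma> = - (\<beta> * \<beta>) / (4 * (a ^ q * a))"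
      by (simp add: \<gamma>_def)
    then show ?thesis
      using aq a_neq_0 four_neq_0 by (simp add: d)
  qed
  \<comment> \<open>The Hilbert 90 expression vanishes at \<open>w = 1\<close> only if
    \<open>\<gamma> ^ q = - 1\<close>, and then at \<open>w = b\<close> it is
    \<open>b - b ^ q\<close>, nonzero because \<open>b\<close> is outside \<open>K\<close>.\<close>
  obtain w where w: "w + \<gamma> ^ q * w ^ q \<noteq> 0"
  proof (cases "\<gamma> ^ q = - 1")
    case True
    then show ?thesis using that[of b] b_notin by (auto simp: mem_K)
  next
    case False
    then show ?thesis using that[of 1] by (auto simp: add_eq_0_iff)
  qed
  define e2 where "e2 = w + \<gamma> ^ q * w ^ q"
  have "e2 \<noteq> 0" using w by (simp add: e2_def)
  have e2: "e2 ^ q = \<gamma> * e2"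
    using \<gamma>q by (simp add: e2_def frob_add power_mult_distrib frob_frob algebra_simps)
  define \<delta> where "\<delta> = a ^ q * (\<gamma> * e2 * \<beta>) ^ 2"
  have h: "h (t * (e2 * b) + u * e2) = \<delta> * t ^ 2" if "t \<in> K" "u \<in> K" for t u
  proof -
    \<comment> \<open>By \<open>e2 ^ q = \<gamma> * e2\<close> the \<open>u\<close> terms cancel,
      and the \<open>t\<close> terms leave the factor \<open>b ^ q - b\<close>.\<close>
    have "(t * (e2 * b) + u * e2) ^ q - \<gamma> * (t * (e2 * b) + u * e2) = \<gamma> * e2 * \<beta> * t"
      using that by (simp add: frob_add power_mult_distrib e2 mem_K \<beta>_def algebra_simps)
    then show ?thesis
      unfolding hx \<delta>_def by (simp only: power_mult_distrib mult.assoc)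
  qed
  have "\<gamma> \<noteq> 0" using \<gamma>q by auto
  then have "\<delta> \<noteq> 0"
    using aq \<open>e2 \<noteq> 0\<close> \<beta>0 by (simp add: \<delta>_def)
  moreover have "\<delta> ^ q = - \<delta>"
  proof -
    \<comment> \<open>Frobenius negates all values of \<open>h\<close>, and \<delta> is the value at
      \<open>e2 * b\<close>.\<close>
    have hq: "h x ^ q = - h x" for x
      by (simp only: h_eq frob_diff power_mult_distrib frob_frob \<beta>q) (simp add: mult.commute)
    show ?thesis
      using hq[of "e2 * b"] h[of 1 0] by simp
  qed
  ultimately show ?thesis
    unfolding basis_like_def using h \<open>e2 \<noteq> 0\<close> by blast
qed

end

section \<open>Counting points on hyperplanes\<close>

lemma bij_betw_inj_on_card:
  assumes "inj_on f A" "f ` A \<subseteq> B" "card A = card B" "finite B"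
  shows "bij_betw f A B"
  using assms card_subset_eq[of B "f ` A"] by (simp add: bij_betw_def card_image)

lemma bij_betw_PiE_comp:
  assumes "\<And>i. i \<in> S \<Longrightarrow> bij_betw (\<phi> i) A B"
  shows "bij_betw (\<lambda>f. \<lambda>i\<in>S. \<phi> i (f i)) (S \<rightarrow>\<^sub>E A) (S \<rightarrow>\<^sub>E B)"
proof -
  have 1: "inv_into A (\<phi> i) (\<phi> i x) = x" "\<phi> i x \<in> B" if "i \<in> S" "x \<in> A" for i x
    using that bij_betw_inv_into_left[OF assms] bij_betw_apply[OF assms] by auto
  have 2: "\<phi> i (inv_into A (\<phi> i) x) = x" "inv_into A (\<phi> i) x \<in> A" if "i \<in> S" "x \<in> B" for i x
    using that bij_betw_inv_into_right[OF assms] bij_betw_apply[OF bij_betw_inv_into[OF assms]] by auto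
  show ?thesis
    by (rule bij_betw_byWitness[where f' = "\<lambda>f. \<lambda>i\<in>S. inv_into A (\<phi> i) (f i)"])
       (auto simp: 1 2 PiE_iff extensional_def fun_eq_iff)
qed

locale quasi_hermitian_basis = quasi_hermitian q TYP a b
  for q :: nat and TYP :: "'a::{field,finite} itself" and a b :: 'a +
  fixes e1 e2 \<delta> :: 'a
  assumes basis: "basis_like e1 e2 \<delta>"
begin

lemma \<delta>_neq_0: "\<delta> \<noteq> 0" and \<delta>_q: "\<delta> ^ q = - \<delta>" and e2_neq_0: "e2 \<noteq> 0"
  and e1_eq: "e1 = e2 * b"
  and h_basis: "t \<in> K \<Longrightarrow> u \<in> K \<Longrightarrow> h (t * e1 + u * e2) = \<delta> * t ^ 2"
  using basis unfolding basis_like_def by blast+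

text \<open>A \<open>K\<close>-linear functional with values in \<open>K\<close> and kernel
  \<open>K\<close>: numerator and denominator are both negated by Frobenius. It turns the equation
  of the point set into one over \<open>K\<close>.\<close>

definition g :: "'a \<Rightarrow> 'a" where "g z = (z ^ q - z) / \<delta>"

lemma g_add: "g (x + y) = g x + g y"
  by (simp add: g_def frob_add diff_divide_distrib add_divide_distrib)

lemma g_0 [simp]: "g 0 = 0"
  using q_gt_2 by (simp add: g_def)

lemma g_sum: "g (\<Sum>i\<in>I. f i) = (\<Sum>i\<in>I. g (f i))"
  by (induction I rule: infinite_finite_induct) (simp_all add: g_add)

lemma g_in_K [simp]: "g z \<in> K"
proof -
  have "g z ^ q = (z - z ^ q) / (- \<delta>)"
    by (simp only: g_def power_divide frob_diff frob_frob \<delta>_q)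
  also have "\<dots> = g z"
    by (simp add: g_def minus_divide_left)
  finally show ?thesis by (simp add: mem_K)
qed

lemma g_scale: "k \<in> K \<Longrightarrow> g (k * z) = k * g z"
  by (simp add: g_def power_mult_distrib mem_K right_diff_distrib)

lemma g_eq_0_iff: "g z = 0 \<longleftrightarrow> z \<in> K"
  using \<delta>_neq_0 by (simp add: g_def mem_K)

lemma card_g_fiber:
  assumes "\<kappa> \<in> K"
  shows "card {z. g z = \<kappa>} = q"
proof -
  have "(\<kappa> * \<delta>) ^ q = - (\<kappa> * \<delta>)"
    using assms by (simp add: power_mult_distrib \<delta>_q mem_K)
  moreover have "g z = \<kappa> \<longleftrightarrow> z ^ q - z = \<kappa> * \<delta>" for z
    using \<delta>_neq_0 by (simp add: g_def divide_eq_eq)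
  ultimately show ?thesis
    using card_frob_minus_id_fiber by simp
qed

text \<open>By cardinality injectivity suffices, and a collision with distinct \<open>t\<close>
  would express \<open>b\<close> as a quotient of elements of \<open>K\<close>.\<close>

lemma bij_basis: "bij_betw (\<lambda>(t, u). t * e1 + u * e2) (K \<times> K) UNIV"
proof (rule bij_betw_inj_on_card)
  show "inj_on (\<lambda>(t, u). t * e1 + u * e2) (K \<times> K)"
  proof (rule inj_onI, clarsimp)
    fix t u t' u' assume K: "t \<in> K" "u \<in> K" "t' \<in> K" "u' \<in> K"
      and eq: "t * e1 + u * e2 = t' * e1 + u' * e2"
    have "((t - t') * b + (u - u')) * e2 = (t * e1 + u * e2) - (t' * e1 + u' * e2)"
      by (simp add: e1_eq algebra_simps)
    then have *: "(t - t') * b + (u - u') = 0"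
      using eq e2_neq_0 by simp
    have "t = t'"
    proof (rule ccontr)
      assume "t \<noteq> t'"
      then have "b = (u' - u) / (t - t')"
        using * by (simp add: field_simps)
      then show False
        using K b_notin K_divide[of "u' - u" "t - t'"] by simp
    qed
    then show "t = t' \<and> u = u'" using * by simp
  qed
qed (simp_all add: card_cartesian_product card_K card_F power2_eq_square)

text \<open>The pairing \<open>g (m * x)\<close> is nondegenerate: if \<open>g\<close> kills both
  products for a nonzero multiplier, these lie in \<open>K\<close>, and so does their quotient
  \<open>b\<close>. Hence a coefficient \<open>m\<close> is the same as a pair of coefficients over
  \<open>K\<close>, one for each basis vector.\<close>

lemma bij_dual: "bij_betw (\<lambda>m. (g (m * e1), g (m * e2))) UNIV (K \<times> K)"
proof (rule bij_betw_inj_on_card)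
  show "inj (\<lambda>m. (g (m * e1), g (m * e2)))"
  proof (rule injI, clarsimp)
    fix m m' assume eq: "g (m * e1) = g (m' * e1)" "g (m * e2) = g (m' * e2)"
    have "g ((m - m') * e) = 0" if "g (m * e) = g (m' * e)" for e
      using that g_add[of "(m - m') * e" "m' * e"] by (simp flip: distrib_right)
    then have K: "(m - m') * e1 \<in> K" "(m - m') * e2 \<in> K"
      using eq by (simp_all flip: g_eq_0_iff)
    show "m = m'"
    proof (rule ccontr)
      assume "m \<noteq> m'"
      then have "b = ((m - m') * e1) / ((m - m') * e2)"
        using e2_neq_0 by (simp add: e1_eq)
      then show False
        using b_notin K_divide[OF K] by simp
    qed
  qed
qed (auto simp: card_cartesian_product card_K card_F power2_eq_square)

text \<open>\<open>hits s d m\<close> counts the points of the affine set on the hyperplane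
  \<open>y = d + (\<Sum>i<s. m i * x i)\<close>, parametrised by \<open>x\<close>.\<close>

definition hits :: "nat \<Rightarrow> 'a \<Rightarrow> (nat \<Rightarrow> 'a) \<Rightarrow> nat" where
  "hits s d m = card {f \<in> {..<s} \<rightarrow>\<^sub>E UNIV.
     (d + (\<Sum>i<s. m i * f i)) ^ q - (d + (\<Sum>i<s. m i * f i)) + (\<Sum>i<s. h (f i)) = 0}"

text \<open>Expand each \<open>x i\<close> in the basis and divide by \<delta>. Because
  \<open>h\<close> has rank one, the second coordinates enter only through the linear part.\<close>

lemma hits_coords:
  "hits s d m = card {p \<in> ({..<s} \<rightarrow>\<^sub>E K) \<times> ({..<s} \<rightarrow>\<^sub>E K).
     g d + (\<Sum>i<s. g (m i * e1) * fst p i + fst p i ^ 2) + (\<Sum>i<s. g (m i * e2) * snd p i) = 0}"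
  unfolding hits_def
proof (rule card_filter_bij_betw[symmetric])
  show "bij_betw (\<lambda>(t, u). \<lambda>i\<in>{..<s}. case (t i, u i) of (t, u) \<Rightarrow> t * e1 + u * e2)
      (({..<s} \<rightarrow>\<^sub>E K) \<times> ({..<s} \<rightarrow>\<^sub>E K)) ({..<s} \<rightarrow>\<^sub>E UNIV)"
    by (rule bij_betw_PiE_pair[OF bij_basis])
  fix p assume p_in: "p \<in> ({..<s} \<rightarrow>\<^sub>E K) \<times> ({..<s} \<rightarrow>\<^sub>E K)"
  obtain t u where p: "p = (t, u)" by fastforce
  define f where "f = (\<lambda>i\<in>{..<s}. t i * e1 + u i * e2)"
  have K: "t i \<in> K" "u i \<in> K" if "i < s" for i
    using p_in that by (auto simp: p PiE_iff)
  let ?z = "d + (\<Sum>i<s. m i * f i)"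
  have "?z ^ q - ?z + (\<Sum>i<s. h (f i)) = \<delta> * (g ?z + (\<Sum>i<s. t i ^ 2))"
  proof -
    have "(\<Sum>i<s. h (f i)) = \<delta> * (\<Sum>i<s. t i ^ 2)"
      by (simp add: f_def h_basis K sum_distrib_left)
    moreover have "?z ^ q - ?z = \<delta> * g ?z"
      using \<delta>_neq_0 by (simp add: g_def)
    ultimately show ?thesis by (simp only: distrib_left)
  qed
  moreover have "g ?z = g d + ((\<Sum>i<s. g (m i * e1) * t i) + (\<Sum>i<s. g (m i * e2) * u i))"
  proof -
    have "g (m i * f i) = g (m i * e1) * t i + g (m i * e2) * u i" if "i < s" for i
    proof -
      have "m i * f i = t i * (m i * e1) + u i * (m i * e2)"
        using that by (simp add: f_def algebra_simps)
      then show ?thesis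
        using K[OF that] by (simp add: g_add g_scale mult.commute)
    qed
    then show ?thesis
      by (simp add: g_add g_sum sum.distrib)
  qed
  ultimately have "?z ^ q - ?z + (\<Sum>i<s. h (f i)) = 0 \<longleftrightarrow>
      g d + (\<Sum>i<s. g (m i * e1) * t i + t i ^ 2) + (\<Sum>i<s. g (m i * e2) * u i) = 0"
    using \<delta>_neq_0 by (simp add: sum.distrib ac_simps)
  then show "g d + (\<Sum>i<s. g (m i * e1) * fst p i + fst p i ^ 2) + (\<Sum>i<s. g (m i * e2) * snd p i) = 0
    \<longleftrightarrow> (d + (\<Sum>i<s. m i * (case p of (t, u) \<Rightarrow> \<lambda>i\<in>{..<s}. case (t i, u i) of (t, u) \<Rightarrow> t * e1 + u * e2) i)) ^ q
      - (d + (\<Sum>i<s. m i * (case p of (t, u) \<Rightarrow> \<lambda>i\<in>{..<s}. case (t i, u i) of (t, u) \<Rightarrow> t * e1 + u * e2) i))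
      + (\<Sum>i<s. h ((case p of (t, u) \<Rightarrow> \<lambda>i\<in>{..<s}. case (t i, u i) of (t, u) \<Rightarrow> t * e1 + u * e2) i)) = 0"
    unfolding p prod.case fst_conv snd_conv f_def by blast
qed

text \<open>For each fixed \<open>t\<close> the condition is one nontrivial linear equation in
  \<open>u\<close>, whatever the quadratic part says.\<close>

lemma hits_nontangent:
  assumes "i < s" "g (m i * e2) \<noteq> 0"
  shows "hits s d m = q ^ (2 * s - 1)"
proof -
  let ?T = "{..<s} \<rightarrow>\<^sub>E K"
  let ?c = "\<lambda>t. - (g d + (\<Sum>i<s. g (m i * e1) * t i + t i ^ 2))"
  have "hits s d m = card {p \<in> ?T \<times> ?T. (\<Sum>i<s. g (m i * e2) * snd p i) = ?c (fst p)}"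
    unfolding hits_coords by (simp only: eq_neg_iff_add_eq_0 add.commute)
  also have "\<dots> = (\<Sum>t\<in>?T. card {u \<in> ?T. (\<Sum>i<s. g (m i * e2) * u i) = ?c t})"
    by (rule card_filter_Times) (simp_all add: finite_PiE)
  also have "\<dots> = (\<Sum>t\<in>?T. q ^ (s - 1))"
  proof (rule sum.cong[OF refl])
    fix t assume t: "t \<in> ?T"
    have "card {u \<in> ?T. (\<Sum>i<s. g (m i * e2) * u i) = ?c t} = card K ^ (card {..<s} - 1)"
    proof (rule card_linear_eq)
      fix u assume "u \<in> {..<s} - {i} \<rightarrow>\<^sub>E K"
      then show "(?c t - (\<Sum>j\<in>{..<s} - {i}. g (m j * e2) * u j)) / g (m i * e2) \<in> K"
        using t by (intro K_divide K_diff K_uminus K_add K_sum K_mult K_power) (auto simp: PiE_iff)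
    qed (use assms in auto)
    then show "card {u \<in> ?T. (\<Sum>i<s. g (m i * e2) * u i) = ?c t} = q ^ (s - 1)"
      by (simp add: card_K)
  qed
  also have "\<dots> = q ^ (s + (s - 1))"
    by (simp add: card_funcsetE card_K power_add)
  also have "s + (s - 1) = 2 * s - 1"
    using assms(1) by simp
  finally show ?thesis .
qed

text \<open>With no \<open>u\<close> present these coordinates are free and give the factor
  \<open>q ^ s\<close>; the shift of \<open>t i\<close> by half its linear coefficient completes the
  squares.\<close>

lemma hits_tangent:
  assumes "\<And>i. i < s \<Longrightarrow> g (m i * e2) = 0"
  shows "hits s d m = q ^ s * nrep s ((\<Sum>i<s. g (m i * e1) ^ 2 / 4) - g d)"
proof -
  let ?T = "{..<s} \<rightarrow>\<^sub>E K"
  let ?\<alpha> = "\<lambda>i. g (m i * e1)"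
  let ?P = "\<lambda>t. g d + (\<Sum>i<s. ?\<alpha> i * t i + t i ^ 2) = 0"
  have "hits s d m = card ({t \<in> ?T. ?P t} \<times> ?T)"
    unfolding hits_coords using assms by (intro arg_cong[where f = card]) auto
  also have "\<dots> = q ^ s * card {t \<in> ?T. ?P t}"
    by (simp add: card_cartesian_product card_funcsetE card_K)
  also have "card {t \<in> ?T. ?P t} = nrep s ((\<Sum>i<s. ?\<alpha> i ^ 2 / 4) - g d)"
    unfolding nrep_def
  proof (rule card_filter_bij_betw)
    show "bij_betw (\<lambda>t. \<lambda>i\<in>{..<s}. t i + ?\<alpha> i / 2) ?T ?T"
    proof (rule bij_betw_PiE_comp)
      show "bij_betw (\<lambda>x. x + ?\<alpha> i / 2) K K" for i
        by (rule bij_betw_byWitness[where f' = "\<lambda>x. x - ?\<alpha> i / 2"]) auto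
    qed
    fix t assume "t \<in> ?T"
    have "(x + y / 2) ^ 2 = (y * x + x ^ 2) + y ^ 2 / 4" for x y :: 'a
    proof -
      have "(x + y / 2) ^ 2 = x ^ 2 + (y / 2) ^ 2 + 2 * x * (y / 2)"
        by (rule power2_sum)
      also have "2 * x * (y / 2) = y * x"
        using two_neq_0 by simp
      finally show ?thesis by (simp add: power_divide)
    qed
    then have "(\<Sum>i<s. ((\<lambda>i\<in>{..<s}. t i + ?\<alpha> i / 2) i) ^ 2)
        = (\<Sum>i<s. ?\<alpha> i * t i + t i ^ 2) + (\<Sum>i<s. ?\<alpha> i ^ 2 / 4)"
      by (simp add: sum.distrib)
    then show "?P t \<longleftrightarrow> (\<Sum>i<s. ((\<lambda>i\<in>{..<s}. t i + ?\<alpha> i / 2) i) ^ 2) = (\<Sum>i<s. ?\<alpha> i ^ 2 / 4) - g d"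
      by (simp only: eq_diff_eq) (simp add: algebra_simps)
  qed
  finally show ?thesis .
qed

end

section \<open>Zero counts summed over all messages\<close>

context quasi_hermitian_basis
begin

text \<open>Every fibre of \<open>g\<close> over \<open>K\<close> has \<open>q\<close> elements, so
  the constant term in \<open>hits_tangent\<close> is equidistributed as \<open>d\<close>
  varies.\<close>

lemma sum_g:
  fixes H :: "'a \<Rightarrow> int poly"
  assumes "c \<in> K"
  shows "(\<Sum>d\<in>UNIV. H (c - g d)) = of_nat q * (\<Sum>\<kappa>\<in>K. H \<kappa>)"
proof -
  have "(\<Sum>d\<in>UNIV. H (c - g d)) = (\<Sum>\<kappa>\<in>K. of_nat (card {d \<in> UNIV. g d = \<kappa>}) * H (c - \<kappa>))"
    by (rule sum_fun_comp) auto
  also have "\<dots> = of_nat q * (\<Sum>\<kappa>\<in>K. H (c - \<kappa>))"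
    by (simp add: card_g_fiber sum_distrib_left)
  also have "(\<Sum>\<kappa>\<in>K. H (c - \<kappa>)) = (\<Sum>\<kappa>\<in>K. H \<kappa>)"
    by (rule sum.reindex_bij_betw[OF bij_diff_K[OF assms]])
  finally show ?thesis .
qed

text \<open>An arbitrary \<open>F\<close> captures the whole distribution of \<open>hits\<close> in
  one identity. In coordinates over \<open>K\<close>, with \<alpha> for the first and \<mu> for the
  second coefficients, only \<open>\<mu> = 0\<close> leads to sums of squares.\<close>

lemma sum_hits:
  fixes F :: "nat \<Rightarrow> int poly"
  assumes "s \<ge> 1"
  shows "(\<Sum>d\<in>UNIV. \<Sum>m\<in>{..<s} \<rightarrow>\<^sub>E UNIV. F (hits s d m))
    = of_nat (q ^ 2 * q ^ s * (q ^ s - 1)) * F (q ^ (2 * s - 1))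
      + of_nat (q ^ (s + 1)) * (\<Sum>\<kappa>\<in>K. F (q ^ s * nrep s \<kappa>))"
proof -
  let ?T = "{..<s} \<rightarrow>\<^sub>E K"
  \<comment> \<open>Recovers \<open>m\<close> from its pair of coefficients over \<open>K\<close>,
    so that the sum over \<open>m\<close> becomes a sum over \<alpha> and \<mu>.\<close>
  let ?\<psi> = "inv_into UNIV (\<lambda>m. (g (m * e1), g (m * e2)))"
  have bij: "bij_betw ?\<psi> (K \<times> K) UNIV"
    by (rule bij_betw_inv_into[OF bij_dual])
  have "(g (?\<psi> p * e1), g (?\<psi> p * e2)) = p" if "p \<in> K \<times> K" for p
    using bij_betw_inv_into_right[OF bij_dual that] by simp
  then have \<psi>: "g (?\<psi> (x, y) * e1) = x" "g (?\<psi> (x, y) * e2) = y" if "x \<in> K" "y \<in> K" for x y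
    using that by fastforce+
  let ?m = "\<lambda>p. case p of (\<alpha>, \<mu>) \<Rightarrow> \<lambda>i\<in>{..<s}. ?\<psi> (\<alpha> i, \<mu> i)"
  let ?z = "\<lambda>i\<in>{..<s}. 0 :: 'a"
  have z: "?z \<in> ?T" by auto
  have card_T: "card ?T = q ^ s" and fin: "finite ?T"
    by (simp_all add: card_funcsetE card_K finite_PiE)
  have hit: "hits s d (?m (\<alpha>, \<mu>)) = (if \<mu> = ?z then q ^ s * nrep s ((\<Sum>i<s. \<alpha> i ^ 2 / 4) - g d)
      else q ^ (2 * s - 1))" if "\<alpha> \<in> ?T" "\<mu> \<in> ?T" for d \<alpha> \<mu>
  proof -
    have coords: "g (?m (\<alpha>, \<mu>) i * e1) = \<alpha> i" "g (?m (\<alpha>, \<mu>) i * e2) = \<mu> i" if "i < s" for i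
      using \<psi>[of "\<alpha> i" "\<mu> i"] \<open>\<alpha> \<in> ?T\<close> \<open>\<mu> \<in> ?T\<close> that by (auto simp: PiE_iff)
    show ?thesis
    proof (cases "\<mu> = ?z")
      case True
      then have "hits s d (?m (\<alpha>, \<mu>)) = q ^ s * nrep s ((\<Sum>i<s. g (?m (\<alpha>, \<mu>) i * e1) ^ 2 / 4) - g d)"
        using coords by (intro hits_tangent) simp
      then show ?thesis
        using True coords by simp
    next
      case False
      then obtain i where "i < s" "\<mu> i \<noteq> 0"
        using PiE_ext[OF \<open>\<mu> \<in> ?T\<close> z] by auto
      then show ?thesis
        using False hits_nontangent[of i s "?m (\<alpha>, \<mu>)" d] coords by simp
    qed
  qed
  have "(\<Sum>m\<in>{..<s} \<rightarrow>\<^sub>E UNIV. F (hits s d m))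
      = of_nat (q ^ s * (q ^ s - 1)) * F (q ^ (2 * s - 1))
        + (\<Sum>\<alpha>\<in>?T. F (q ^ s * nrep s ((\<Sum>i<s. \<alpha> i ^ 2 / 4) - g d)))" for d
  proof -
    have "(\<Sum>m\<in>{..<s} \<rightarrow>\<^sub>E UNIV. F (hits s d m)) = (\<Sum>p\<in>?T \<times> ?T. F (hits s d (?m p)))"
      by (rule sum.reindex_bij_betw[OF bij_betw_PiE_pair[OF bij], symmetric])
    also have "\<dots> = (\<Sum>\<alpha>\<in>?T. \<Sum>\<mu>\<in>?T. F (hits s d (?m (\<alpha>, \<mu>))))"
      by (subst sum.cartesian_product) (auto intro!: sum.cong)
    also have "\<dots> = (\<Sum>\<alpha>\<in>?T. F (q ^ s * nrep s ((\<Sum>i<s. \<alpha> i ^ 2 / 4) - g d))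
        + of_nat (q ^ s - 1) * F (q ^ (2 * s - 1)))"
    proof (rule sum.cong[OF refl])
      fix \<alpha> assume \<alpha>: "\<alpha> \<in> ?T"
      have "(\<Sum>\<mu>\<in>?T. F (hits s d (?m (\<alpha>, \<mu>))))
          = F (hits s d (?m (\<alpha>, ?z))) + (\<Sum>\<mu>\<in>?T - {?z}. F (hits s d (?m (\<alpha>, \<mu>))))"
        by (rule sum.remove[OF fin z])
      also have "(\<Sum>\<mu>\<in>?T - {?z}. F (hits s d (?m (\<alpha>, \<mu>)))) = (\<Sum>\<mu>\<in>?T - {?z}. F (q ^ (2 * s - 1)))"
        using hit[OF \<alpha>] by (intro sum.cong) auto
      also have "\<dots> = of_nat (q ^ s - 1) * F (q ^ (2 * s - 1))"
        using card_Diff_singleton[OF z] by (simp add: card_T)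
      finally show "(\<Sum>\<mu>\<in>?T. F (hits s d (?m (\<alpha>, \<mu>))))
          = F (q ^ s * nrep s ((\<Sum>i<s. \<alpha> i ^ 2 / 4) - g d)) + of_nat (q ^ s - 1) * F (q ^ (2 * s - 1))"
        by (simp only: hit[OF \<alpha> z] refl if_True)
    qed
    finally show ?thesis
      by (simp add: sum.distrib card_T)
  qed
  then have "(\<Sum>d\<in>UNIV. \<Sum>m\<in>{..<s} \<rightarrow>\<^sub>E UNIV. F (hits s d m))
      = (\<Sum>d\<in>(UNIV :: 'a set). of_nat (q ^ s * (q ^ s - 1)) * F (q ^ (2 * s - 1)))
        + (\<Sum>d\<in>UNIV. \<Sum>\<alpha>\<in>?T. F (q ^ s * nrep s ((\<Sum>i<s. \<alpha> i ^ 2 / 4) - g d)))"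
    by (simp only: sum.distrib)
  also have "(\<Sum>d\<in>(UNIV :: 'a set). of_nat (q ^ s * (q ^ s - 1)) * F (q ^ (2 * s - 1)))
      = of_nat (q ^ 2 * q ^ s * (q ^ s - 1)) * F (q ^ (2 * s - 1))"
    by (simp add: card_F mult.assoc)
  also have "(\<Sum>d\<in>UNIV. \<Sum>\<alpha>\<in>?T. F (q ^ s * nrep s ((\<Sum>i<s. \<alpha> i ^ 2 / 4) - g d)))
      = (\<Sum>\<alpha>\<in>?T. \<Sum>d\<in>UNIV. F (q ^ s * nrep s ((\<Sum>i<s. \<alpha> i ^ 2 / 4) - g d)))"
    by (rule sum.swap)
  also have "\<dots> = (\<Sum>\<alpha>\<in>?T. of_nat q * (\<Sum>\<kappa>\<in>K. F (q ^ s * nrep s \<kappa>)))"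
  proof (rule sum.cong[OF refl])
    fix \<alpha> assume "\<alpha> \<in> ?T"
    then have "(\<Sum>i<s. \<alpha> i ^ 2 / 4) \<in> K"
      by (intro K_sum K_divide K_power) (auto simp: PiE_iff)
    then show "(\<Sum>d\<in>UNIV. F (q ^ s * nrep s ((\<Sum>i<s. \<alpha> i ^ 2 / 4) - g d)))
        = of_nat q * (\<Sum>\<kappa>\<in>K. F (q ^ s * nrep s \<kappa>))"
      by (rule sum_g[where H = "\<lambda>\<kappa>. F (q ^ s * nrep s \<kappa>)"])
  qed
  also have "\<dots> = of_nat (q ^ (s + 1)) * (\<Sum>\<kappa>\<in>K. F (q ^ s * nrep s \<kappa>))"
    by (simp add: card_T mult_ac)
  finally show ?thesis .
qed

definition B_pairs :: "nat \<Rightarrow> ((nat \<Rightarrow> 'a) \<times> 'a) set" where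
  "B_pairs s = {p \<in> ({..<s} \<rightarrow>\<^sub>E UNIV) \<times> UNIV. snd p ^ q - snd p + (\<Sum>i<s. h (fst p i)) = 0}"

text \<open>\<open>B_pairs s\<close> is the affine set with \<open>x\<^sub>r\<close> split off from \<open>x\<^sub>1, \<dots>, x\<^sub>s\<close>, and
  \<open>zeros s c0 m c\<close> counts the zero entries of the codeword with message \<open>(c0, m, c)\<close>.\<close>

definition zeros :: "nat \<Rightarrow> 'a \<Rightarrow> (nat \<Rightarrow> 'a) \<Rightarrow> 'a \<Rightarrow> nat" where
  "zeros s c0 m c = card {p \<in> B_pairs s. c0 + (\<Sum>i<s. m i * fst p i) + c * snd p = 0}"

text \<open>Guarantees that \<open>y ^ q - y\<close> can take the value required by any choice of
  the other coordinates.\<close>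

lemma h_antifixed: "h x ^ q = - h x"
proof -
  have "x \<in> (\<lambda>(t, u). t * e1 + u * e2) ` (K \<times> K)"
    using bij_basis by (simp add: bij_betw_def)
  then obtain p where p: "x = (\<lambda>(t, u). t * e1 + u * e2) p" "p \<in> K \<times> K"
    by (rule imageE)
  obtain t u where "p = (t, u)"
    by (cases p)
  with p have tu: "t \<in> K" "u \<in> K" "x = t * e1 + u * e2"
    by simp_all
  have "(t ^ 2) ^ q = t ^ 2"
    using K_power[OF tu(1), of 2] unfolding mem_K .
  then show ?thesis
    by (simp only: tu(3) h_basis[OF tu(1,2)] power_mult_distrib \<delta>_q mult_minus_left)
qed

lemma card_fiber_y:
  "card {y. y ^ q - y + (\<Sum>i<s. h (f i)) = 0} = q"
proof -
  have "(- (\<Sum>i<s. h (f i))) ^ q = - (- (\<Sum>i<s. h (f i)))"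
    by (simp add: frob_uminus frob_sum h_antifixed sum_negf)
  then have "card {y. y ^ q - y = - (\<Sum>i<s. h (f i))} = q"
    by (rule card_frob_minus_id_fiber)
  then show ?thesis
    by (simp add: eq_neg_iff_add_eq_0)
qed

text \<open>Over every choice of the first \<open>s\<close> coordinates lie exactly \<open>q\<close>
  points, so a condition on these coordinates alone is counted \<open>q\<close> times.\<close>

lemma card_B_pairs_filter:
  "card {p \<in> B_pairs s. P (fst p)} = q * card {f \<in> {..<s} \<rightarrow>\<^sub>E UNIV. P f}"
proof -
  let ?T = "{..<s} \<rightarrow>\<^sub>E (UNIV :: 'a set)"
  have "{p \<in> B_pairs s. P (fst p)}
      = (SIGMA f:{f \<in> ?T. P f}. {y. y ^ q - y + (\<Sum>i<s. h (f i)) = 0})"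
  proof (rule Set.set_eqI)
    fix p :: "(nat \<Rightarrow> 'a) \<times> 'a"
    obtain f y where p: "p = (f, y)" by fastforce
    show "p \<in> {p \<in> B_pairs s. P (fst p)}
        \<longleftrightarrow> p \<in> (SIGMA f:{f \<in> ?T. P f}. {y. y ^ q - y + (\<Sum>i<s. h (f i)) = 0})"
      unfolding p B_pairs_def mem_Collect_eq mem_Sigma_iff fst_conv snd_conv by blast
  qed
  moreover have "finite {f \<in> ?T. P f}"
    by (simp add: finite_PiE)
  ultimately show ?thesis
    by (simp add: card_fiber_y)
qed

lemma card_B_pairs: "card (B_pairs s) = q ^ (2 * s + 1)"
  using card_B_pairs_filter[of s "\<lambda>_. True"] by (simp add: card_funcsetE card_F power_mult)

lemma zeros_vertical:
  assumes "i < s" "m i \<noteq> 0"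
  shows "zeros s c0 m 0 = q ^ (2 * s - 1)"
proof -
  have "zeros s c0 m 0 = q * card {f \<in> {..<s} \<rightarrow>\<^sub>E UNIV. (\<Sum>i<s. m i * f i) = - c0}"
    unfolding zeros_def using card_B_pairs_filter[of s "\<lambda>f. (\<Sum>i<s. m i * f i) = - c0"]
    by (simp add: eq_neg_iff_add_eq_0 add.commute)
  also have "card {f \<in> {..<s} \<rightarrow>\<^sub>E UNIV. (\<Sum>i<s. m i * f i) = - c0} = (q ^ 2) ^ (s - 1)"
    using card_linear_eq[of "{..<s}" i m UNIV "- c0"] assms by (simp add: card_F)
  also have "q * (q ^ 2) ^ (s - 1) = q ^ (1 + 2 * (s - 1))"
    by (simp add: power_mult)
  also have "1 + 2 * (s - 1) = 2 * s - 1"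
    using assms(1) by simp
  finally show ?thesis .
qed

text \<open>A nonzero \<open>c\<close> allows solving for the last coordinate; the restriction of
  \<open>- m i / c\<close> keeps the new coefficients in the extensional function space summed over
  in \<open>sum_hits\<close>.\<close>

lemma zeros_graph:
  assumes "c \<noteq> 0"
  shows "zeros s c0 m c = hits s (- c0 / c) (\<lambda>i\<in>{..<s}. - m i / c)"
proof -
  let ?T = "{..<s} \<rightarrow>\<^sub>E (UNIV :: 'a set)"
  let ?y = "\<lambda>f. - c0 / c + (\<Sum>i<s. (\<lambda>i\<in>{..<s}. - m i / c) i * f i)"
  have y_eq: "?y f = - (c0 + (\<Sum>i<s. m i * f i)) / c" for f
    by (simp add: sum_negf diff_divide_distrib sum_divide_distrib)
  have y: "c0 + (\<Sum>i<s. m i * f i) + c * z = 0 \<longleftrightarrow> z = ?y f" for f z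
  proof -
    have "z = - w / c \<longleftrightarrow> w + c * z = 0" for w
      unfolding nonzero_eq_divide_eq[OF assms] eq_neg_iff_add_eq_0
      by (simp only: add.commute mult.commute)
    then show ?thesis
      by (simp only: y_eq)
  qed
  have "{p \<in> B_pairs s. c0 + (\<Sum>i<s. m i * fst p i) + c * snd p = 0}
      = (\<lambda>f. (f, ?y f)) ` {f \<in> ?T. ?y f ^ q - ?y f + (\<Sum>i<s. h (f i)) = 0}"
  proof (rule Set.set_eqI)
    fix p :: "(nat \<Rightarrow> 'a) \<times> 'a"
    obtain f z where p: "p = (f, z)" by fastforce
    show "p \<in> {p \<in> B_pairs s. c0 + (\<Sum>i<s. m i * fst p i) + c * snd p = 0}
        \<longleftrightarrow> p \<in> (\<lambda>f. (f, ?y f)) ` {f \<in> ?T. ?y f ^ q - ?y f + (\<Sum>i<s. h (f i)) = 0}"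
      unfolding p B_pairs_def mem_Collect_eq mem_Sigma_iff fst_conv snd_conv y image_iff prod.inject
      by blast
  qed
  then have "zeros s c0 m c = card ((\<lambda>f. (f, ?y f)) ` {f \<in> ?T. ?y f ^ q - ?y f + (\<Sum>i<s. h (f i)) = 0})"
    by (simp only: zeros_def)
  also have "\<dots> = hits s (- c0 / c) (\<lambda>i\<in>{..<s}. - m i / c)"
    unfolding hits_def by (rule card_image) (auto intro: inj_onI)
  finally show ?thesis .
qed

text \<open>The terms in order: the zero message; the nonzero constants, which never vanish;
  hyperplanes with \<open>q ^ (2 * s - 1)\<close> points, namely those with \<open>c = 0\<close> and
  nonzero \<open>m\<close> together with the nontangent graphs; and the tangent graphs.\<close>

lemma sum_zeros:
  fixes F :: "nat \<Rightarrow> int poly"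
  assumes "s \<ge> 1"
  shows "(\<Sum>c\<in>UNIV. \<Sum>c0\<in>UNIV. \<Sum>m\<in>{..<s} \<rightarrow>\<^sub>E UNIV. F (zeros s c0 m c))
    = F (q ^ (2 * s + 1)) + of_nat (q ^ 2 - 1) * F 0
      + of_nat (q ^ 2 * (q ^ (2 * s) - 1) + (q ^ 2 - 1) * (q ^ 2 * q ^ s * (q ^ s - 1))) * F (q ^ (2 * s - 1))
      + of_nat ((q ^ 2 - 1) * q ^ (s + 1)) * (\<Sum>\<kappa>\<in>K. F (q ^ s * nrep s \<kappa>))"
proof -
  let ?T = "{..<s} \<rightarrow>\<^sub>E (UNIV :: 'a set)"
  let ?z = "\<lambda>i\<in>{..<s}. 0 :: 'a"
  let ?S = "\<lambda>c. \<Sum>c0\<in>UNIV. \<Sum>m\<in>?T. F (zeros s c0 m c)"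
  have z: "?z \<in> ?T" and fin: "finite ?T"
    by (auto simp: finite_PiE)
  have card_T: "card ?T = q ^ (2 * s)"
    by (simp add: card_funcsetE card_F power_mult)
  have card_U: "card (UNIV - {0 :: 'a}) = q ^ 2 - 1"
    by (simp add: card_Diff_singleton card_F)
  \<comment> \<open>Division by \<open>- c\<close> permutes the constants and the coefficient
    tuples, so the inner sum is the same for every nonzero \<open>c\<close>.\<close>
  have "?S c = (\<Sum>d\<in>UNIV. \<Sum>m\<in>?T. F (hits s d m))" if "c \<noteq> 0" for c
  proof -
    have b1: "bij_betw (\<lambda>c0. - c0 / c) UNIV UNIV"
      by (rule bij_betw_byWitness[where f' = "\<lambda>d. - d * c"]) (use that in auto)
    have b2: "bij_betw (\<lambda>m. \<lambda>i\<in>{..<s}. - m i / c) ?T ?T"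
    proof (rule bij_betw_PiE_comp)
      show "bij_betw (\<lambda>x. - x / c) UNIV UNIV" for i :: nat
        by (rule bij_betw_byWitness[where f' = "\<lambda>d. - d * c"]) (use that in auto)
    qed
    have "?S c = (\<Sum>c0\<in>UNIV. \<Sum>m\<in>?T. F (hits s (- c0 / c) (\<lambda>i\<in>{..<s}. - m i / c)))"
      by (simp only: zeros_graph[OF that])
    also have "\<dots> = (\<Sum>c0\<in>UNIV. \<Sum>m\<in>?T. F (hits s (- c0 / c) m))"
      by (intro sum.cong refl sum.reindex_bij_betw[OF b2])
    also have "\<dots> = (\<Sum>d\<in>UNIV. \<Sum>m\<in>?T. F (hits s d m))"
      by (rule sum.reindex_bij_betw[OF b1])
    finally show ?thesis .
  qed
  then have nonzero: "(\<Sum>c\<in>UNIV - {0}. ?S c)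
      = of_nat (q ^ 2 - 1) * (\<Sum>d\<in>UNIV. \<Sum>m\<in>?T. F (hits s d m))"
    using card_U by simp
  have zeros_0: "zeros s c0 ?z 0 = (if c0 = 0 then q ^ (2 * s + 1) else 0)" for c0
    by (simp add: zeros_def card_B_pairs)
  have "?S 0 = (\<Sum>c0\<in>UNIV. F (zeros s c0 ?z 0) + of_nat (q ^ (2 * s) - 1) * F (q ^ (2 * s - 1)))"
  proof (rule sum.cong[OF refl])
    fix c0
    have "(\<Sum>m\<in>?T. F (zeros s c0 m 0)) = F (zeros s c0 ?z 0) + (\<Sum>m\<in>?T - {?z}. F (zeros s c0 m 0))"
      by (rule sum.remove[OF fin z])
    also have "(\<Sum>m\<in>?T - {?z}. F (zeros s c0 m 0)) = (\<Sum>m\<in>?T - {?z}. F (q ^ (2 * s - 1)))"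
    proof (rule sum.cong[OF refl])
      fix m assume m: "m \<in> ?T - {?z}"
      then obtain i where "i < s" "m i \<noteq> 0"
        using PiE_ext[OF _ z, of m] by auto
      then show "F (zeros s c0 m 0) = F (q ^ (2 * s - 1))"
        by (simp add: zeros_vertical)
    qed
    also have "\<dots> = of_nat (q ^ (2 * s) - 1) * F (q ^ (2 * s - 1))"
      using card_Diff_singleton[OF z] by (simp add: card_T)
    finally show "(\<Sum>m\<in>?T. F (zeros s c0 m 0))
        = F (zeros s c0 ?z 0) + of_nat (q ^ (2 * s) - 1) * F (q ^ (2 * s - 1))" .
  qed
  also have "\<dots> = (\<Sum>c0\<in>UNIV. F (zeros s c0 ?z 0))
      + of_nat (q ^ 2 * (q ^ (2 * s) - 1)) * F (q ^ (2 * s - 1))"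
    by (simp add: sum.distrib card_F mult.assoc)
  also have "(\<Sum>c0\<in>UNIV. F (zeros s c0 ?z 0)) = F (zeros s 0 ?z 0) + (\<Sum>c0\<in>UNIV - {0}. F (zeros s c0 ?z 0))"
    by (rule sum.remove) auto
  also have "(\<Sum>c0\<in>UNIV - {0}. F (zeros s c0 ?z 0)) = (\<Sum>c0\<in>UNIV - {0 :: 'a}. F 0)"
    by (rule sum.cong) (simp_all add: zeros_0 del: restrict_apply)
  also have "\<dots> = of_nat (q ^ 2 - 1) * F 0"
    using card_U by simp
  finally have zero: "?S 0 = F (q ^ (2 * s + 1)) + of_nat (q ^ 2 - 1) * F 0
      + of_nat (q ^ 2 * (q ^ (2 * s) - 1)) * F (q ^ (2 * s - 1))"
    by (simp only: zeros_0 simp_thms if_True)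
  have "(\<Sum>c\<in>UNIV. ?S c) = ?S 0 + (\<Sum>c\<in>UNIV - {0}. ?S c)"
    by (rule sum.remove) auto
  then show ?thesis
    unfolding zero nonzero sum_hits[OF assms, of F] of_nat_add of_nat_mult distrib_left distrib_right
    by (simp only: add.assoc mult.assoc)
qed

end

section \<open>Codes generated from sets of points\<close>

text \<open>No weight exceeds the length, so cutting the defining sum off at \<open>n\<close> loses
  nothing.\<close>

lemma coeff_weight_enumerator:
  assumes "C \<subseteq> carrier_vec n"
  shows "poly.coeff (weight_enumerator n C) i = int (weight_count C i)"
proof -
  have "hamming_weight c \<le> n" if "c \<in> C" for c
  proof -
    have "card {j. j < dim_vec c \<and> c $ j \<noteq> 0} \<le> card {..<dim_vec c}"
      by (intro card_mono) auto
    then show ?thesis using assms that by (auto simp: hamming_weight_def)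
  qed
  then have "{c \<in> C. hamming_weight c = i} = {}" if "i > n"
    using that by fastforce
  then have "weight_count C i = 0" if "i > n"
    using that by (simp only: weight_count_def card.empty)
  then show ?thesis
    by (cases "i > n") (simp_all add: weight_enumerator_def coeff_sum Polynomial.coeff_monom)
qed

lemma weight_enumerator_eq_sum:
  assumes "finite C" "C \<subseteq> carrier_vec n"
  shows "weight_enumerator n C = (\<Sum>c\<in>C. Polynomial.monom 1 (hamming_weight c))"
proof (rule poly_eqI)
  fix i
  have "poly.coeff (\<Sum>c\<in>C. Polynomial.monom 1 (hamming_weight c)) i
      = (\<Sum>c\<in>C. if hamming_weight c = i then 1 else 0 :: int)"
    by (simp add: coeff_sum Polynomial.coeff_monom)
  also have "\<dots> = int (weight_count C i)"
    using assms(1) by (simp add: weight_count_def sum.If_cases Int_def)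
  finally show "poly.coeff (weight_enumerator n C) i
      = poly.coeff (\<Sum>c\<in>C. Polynomial.monom 1 (hamming_weight c)) i"
    using coeff_weight_enumerator[OF assms(2)] by simp
qed

lemma finite_carrier_vec: "finite (carrier_vec n :: 'a::finite vec set)"
proof -
  have "(carrier_vec n :: 'a vec set) \<subseteq> vec n ` ({..<n} \<rightarrow>\<^sub>E UNIV)"
  proof
    fix v :: "'a vec" assume "v \<in> carrier_vec n"
    then have eq: "v = vec n (\<lambda>i\<in>{..<n}. v $ i)"
      by (intro eq_vecI) auto
    have "vec n (\<lambda>i\<in>{..<n}. v $ i) \<in> vec n ` ({..<n} \<rightarrow>\<^sub>E UNIV)"
      by (rule imageI) (simp add: PiE_iff extensional_def)
    then show "v \<in> vec n ` ({..<n} \<rightarrow>\<^sub>E UNIV)"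
      by (subst eq)
  qed
  then show ?thesis
    by (rule finite_subset) (simp add: finite_PiE)
qed

lemma mem_proj_point: "w \<in> proj_point v \<longleftrightarrow> (\<exists>c. w = c \<cdot>\<^sub>v v)"
  by (auto simp: proj_point_def)

lemma self_mem_proj_point: "v \<in> proj_point v"
  unfolding mem_proj_point by (rule exI[of _ 1]) simp

text \<open>Columns of \<open>G\<close> are nonzero multiples of the representatives in
  \<open>X\<close>, so zero positions of a codeword can be counted on \<open>X\<close>. By
  \<open>nondeg\<close> encoding is injective, which gives the dimension and replaces the sum over
  codewords by one over messages.\<close>

lemma generated_code:
  fixes X :: "'a::{field,finite} vec set"
  assumes gen: "generates_code r (proj_point ` X) n C"
    and X: "X \<subseteq> carrier_vec (r + 1)" and inj: "inj_on proj_point X"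
    and X0: "0\<^sub>v (r + 1) \<notin> X"
    and nondeg: "\<And>v. v \<in> carrier_vec (r + 1) \<Longrightarrow> (\<And>x. x \<in> X \<Longrightarrow> v \<bullet> x = 0) \<Longrightarrow> v = 0\<^sub>v (r + 1)"
  shows "n = card X" and "code_dim n C = r + 1" and "C \<subseteq> carrier_vec n"
    and "weight_enumerator n C
      = (\<Sum>v\<in>carrier_vec (r + 1). Polynomial.monom 1 (n - card {x \<in> X. v \<bullet> x = 0}))"
proof -
  obtain G where G: "G \<in> carrier_mat (r + 1) n"
    and bij: "bij_betw (\<lambda>j. proj_point (col G j)) {..<n} (proj_point ` X)"
    and C: "C = vec_space.row_space n G"
    using gen by (auto simp: generates_code_def)
  \<comment> \<open>The representative in \<open>X\<close> of the point spanned by column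
    \<open>j\<close>.\<close>
  define \<sigma> where "\<sigma> = inv_into X proj_point \<circ> (\<lambda>j. proj_point (col G j))"
  have bij\<sigma>: "bij_betw \<sigma> {..<n} X"
    unfolding \<sigma>_def
    by (rule bij_betw_trans[OF bij bij_betw_inv_into[OF inj_on_imp_bij_betw[OF inj]]])
  then show n: "n = card X"
    using bij_betw_same_card by fastforce
  have finX: "finite X"
    using bij\<sigma> bij_betw_finite by blast
  have \<sigma>: "\<exists>c. c \<noteq> 0 \<and> col G j = c \<cdot>\<^sub>v \<sigma> j" if "j < n" for j
  proof -
    have "proj_point (col G j) \<in> proj_point ` X"
      using bij_betw_apply[OF bij] that by simp
    then have "proj_point (\<sigma> j) = proj_point (col G j)"
      by (simp add: \<sigma>_def f_inv_into_f)
    then have "col G j \<in> proj_point (\<sigma> j)" "\<sigma> j \<in> proj_point (col G j)"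
      using self_mem_proj_point by metis+
    then obtain c d where c: "col G j = c \<cdot>\<^sub>v \<sigma> j" and d: "\<sigma> j = d \<cdot>\<^sub>v col G j"
      unfolding mem_proj_point by blast
    have \<sigma>X: "\<sigma> j \<in> X"
      using bij_betw_apply[OF bij\<sigma>] that by simp
    \<comment> \<open>A vanishing column would force its multiple \<open>\<sigma> j\<close> to
      vanish, against \<open>X0\<close>.\<close>
    have "c \<noteq> 0"
    proof
      assume "c = 0"
      moreover have "\<sigma> j \<in> carrier_vec (r + 1)"
        using \<sigma>X X by blast
      ultimately have "col G j = 0\<^sub>v (r + 1)"
        using c by (intro eq_vecI) auto
      then have "\<sigma> j = 0\<^sub>v (r + 1)"
        unfolding d by (intro eq_vecI) auto
      then show False using \<sigma>X X0 by simp
    qed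
    then show ?thesis using c by blast
  qed
  let ?E = "\<lambda>v. G\<^sup>T *\<^sub>v v"
  have GT: "G\<^sup>T \<in> carrier_mat n (r + 1)"
    using G by simp
  have E_carrier: "?E v \<in> carrier_vec n" for v
    using G by (intro carrier_vecI) simp
  have E_index: "?E v $ j = col G j \<bullet> v" if "j < n" for v j
    using G that by simp
  have E_zero_iff: "?E v $ j = 0 \<longleftrightarrow> v \<bullet> \<sigma> j = 0" if "j < n" "v \<in> carrier_vec (r + 1)" for v j
  proof -
    obtain c where c: "c \<noteq> 0" "col G j = c \<cdot>\<^sub>v \<sigma> j"
      using \<sigma>[OF \<open>j < n\<close>] by blast
    have "\<sigma> j \<in> carrier_vec (r + 1)"
      using bij_betw_apply[OF bij\<sigma>] that(1) X by blast
    then show ?thesis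
      using that c by (simp add: E_index comm_scalar_prod[of v "r + 1" "\<sigma> j"])
  qed
  have C_eq: "C = ?E ` carrier_vec (r + 1)"
    using E_carrier G unfolding C vec_space.row_space_eq[OF G] by auto
  show C_sub: "C \<subseteq> carrier_vec n"
    using E_carrier by (auto simp: C_eq)
  have weight: "hamming_weight (?E v) = n - card {x \<in> X. v \<bullet> x = 0}"
    if "v \<in> carrier_vec (r + 1)" for v
  proof -
    have "hamming_weight (?E v) = card {j \<in> {..<n}. v \<bullet> \<sigma> j \<noteq> 0}"
      unfolding hamming_weight_def
      using E_zero_iff[OF _ that] G by (intro arg_cong[where f = card]) auto
    also have "\<dots> = card {x \<in> X. v \<bullet> x \<noteq> 0}"
      by (rule card_filter_bij_betw[OF bij\<sigma>]) simp
    also have "{x \<in> X. v \<bullet> x \<noteq> 0} = X - {x \<in> X. v \<bullet> x = 0}"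
      by auto
    also have "card \<dots> = n - card {x \<in> X. v \<bullet> x = 0}"
      using finX by (simp add: card_Diff_subset n)
    finally show ?thesis .
  qed
  have ker: "v = 0\<^sub>v (r + 1)" if v: "v \<in> carrier_vec (r + 1)" and "?E v = 0\<^sub>v n" for v
  proof (rule nondeg[OF v])
    fix x assume "x \<in> X"
    then obtain j where "j < n" "x = \<sigma> j"
      using bij\<sigma> by (auto simp: bij_betw_def)
    then show "v \<bullet> x = 0"
      using E_zero_iff[OF _ v, of j] that by simp
  qed
  have inj_E: "inj_on ?E (carrier_vec (r + 1))"
  proof (rule inj_onI)
    fix v w assume vw: "v \<in> carrier_vec (r + 1)" "w \<in> carrier_vec (r + 1)" and "?E v = ?E w"
    then have "?E (v - w) = 0\<^sub>v n"
      using E_carrier[of w] by (simp add: mult_minus_distrib_mat_vec[OF GT])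
    then have "v - w = 0\<^sub>v (r + 1)"
      using ker vw by simp
    then show "v = w"
      using vw by (intro eq_vecI) (auto simp: vec_eq_iff)
  qed
  show "weight_enumerator n C
      = (\<Sum>v\<in>carrier_vec (r + 1). Polynomial.monom 1 (n - card {x \<in> X. v \<bullet> x = 0}))"
  proof -
    have "weight_enumerator n C = (\<Sum>c\<in>C. Polynomial.monom 1 (hamming_weight c))"
      using C_sub by (intro weight_enumerator_eq_sum) (auto intro: finite_subset[OF _ finite_carrier_vec])
    also have "\<dots> = (\<Sum>v\<in>carrier_vec (r + 1). Polynomial.monom 1 (hamming_weight (?E v)))"
      unfolding C_eq by (rule sum.reindex_cong[OF inj_E]) auto
    finally show ?thesis
      by (simp add: weight)
  qed
  interpret vec_space "TYPE('a)" n .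
  have col_eq: "col G\<^sup>T i = ?E (unit_vec (r + 1) i)" if "i < r + 1" for i
    using that G by (intro eq_vecI) auto
  \<comment> \<open>Independence concerns the set of columns, so distinctness is what makes that set
    have \<open>r + 1\<close> elements.\<close>
  have dist: "distinct (cols G\<^sup>T)"
    unfolding distinct_conv_nth
  proof (intro allI impI)
    fix i j assume "i < length (cols G\<^sup>T)" "j < length (cols G\<^sup>T)" "i \<noteq> j"
    then have ij: "i < r + 1" "j < r + 1" "i \<noteq> j"
      using G by auto
    then have "?E (unit_vec (r + 1) i) \<noteq> ?E (unit_vec (r + 1) j)"
      using inj_onD[OF inj_E, of "unit_vec (r + 1) i" "unit_vec (r + 1) j"] by auto
    then show "cols G\<^sup>T ! i \<noteq> cols G\<^sup>T ! j"
      using ij G col_eq by auto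
  qed
  have "lin_indpt (set (cols G\<^sup>T))"
    using lin_depE[OF GT _ dist] ker by blast
  then have "rank G\<^sup>T = r + 1"
    using lin_indpt_full_rank[OF GT dist] by blast
  then show "code_dim n C = r + 1"
    unfolding rank_def code_dim_def C row_space_def by simp
qed

section \<open>The weight enumerator\<close>

context quasi_hermitian_basis
begin

text \<open>The same packing is used for affine points and for messages without their constant term,
  so that the scalar product is the linear form in \<open>zeros\<close>.\<close>

definition glue :: "nat \<Rightarrow> (nat \<Rightarrow> 'a) \<times> 'a \<Rightarrow> 'a vec" where
  "glue s p = vec (s + 1) (\<lambda>i. if i < s then fst p i else snd p)"

lemma glue_carrier [simp]: "glue s p \<in> carrier_vec (Suc s)"
  by (simp add: glue_def)

lemma glue_index: "i < s \<Longrightarrow> glue s p $ i = fst p i" "glue s p $ s = snd p"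
  by (simp_all add: glue_def)

lemma glue_scalar_prod:
  "glue s p \<bullet> glue s p' = (\<Sum>i<s. fst p i * fst p' i) + snd p * snd p'"
  by (simp add: scalar_prod_def glue_def lessThan_atLeast0)

lemma bij_glue: "bij_betw (glue s) (({..<s} \<rightarrow>\<^sub>E UNIV) \<times> UNIV) (carrier_vec (s + 1))"
proof (rule bij_betw_byWitness[where f' = "\<lambda>v. (\<lambda>i\<in>{..<s}. v $ i, v $ s)"])
  show "\<forall>p\<in>({..<s} \<rightarrow>\<^sub>E UNIV) \<times> UNIV. (\<lambda>i\<in>{..<s}. glue s p $ i, glue s p $ s) = p"
    by (auto simp: glue_index fun_eq_iff PiE_iff extensional_def)
  show "\<forall>v\<in>carrier_vec (s + 1). glue s (\<lambda>i\<in>{..<s}. v $ i, v $ s) = v"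
    by (auto simp: glue_def less_Suc_eq)
  show "glue s ` (({..<s} \<rightarrow>\<^sub>E UNIV) \<times> UNIV) \<subseteq> carrier_vec (s + 1)"
    by (rule image_subsetI) simp
  show "(\<lambda>v. (\<lambda>i\<in>{..<s}. v $ i, v $ s)) ` carrier_vec (s + 1) \<subseteq> ({..<s} \<rightarrow>\<^sub>E UNIV) \<times> UNIV"
    by (rule image_subsetI) (simp add: PiE_iff extensional_def)
qed

lemma glue_mem_B_affine:
  assumes "p \<in> ({..<s} \<rightarrow>\<^sub>E UNIV) \<times> UNIV"
  shows "glue s p \<in> B_affine q (s + 1) a b \<longleftrightarrow> p \<in> B_pairs s"
proof -
  have "(\<Sum>i<s. h (fst p i)) = a ^ q * (\<Sum>i<s. fst p i ^ (2 * q)) - a * (\<Sum>i<s. fst p i ^ 2)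
      - (b ^ q - b) * (\<Sum>i<s. fst p i ^ (q + 1))"
    by (simp only: h_def sum_subtractf sum_distrib_left)
  then have "snd p ^ q - snd p + (\<Sum>i<s. h (fst p i)) = 0 \<longleftrightarrow>
      snd p ^ q - snd p + a ^ q * (\<Sum>i<s. fst p i ^ (2 * q)) - a * (\<Sum>i<s. fst p i ^ 2)
      = (b ^ q - b) * (\<Sum>i<s. fst p i ^ (q + 1))"
    by (simp only: add_diff_eq right_minus_eq)
  then show ?thesis
    using assms by (simp add: B_affine_def B_pairs_def glue_index)
qed

lemma bij_glue_B: "bij_betw (glue s) (B_pairs s) (B_affine q (s + 1) a b)"
proof -
  have "glue s ` B_pairs s = B_affine q (s + 1) a b"
  proof
    show "glue s ` B_pairs s \<subseteq> B_affine q (s + 1) a b"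
    proof
      fix x assume "x \<in> glue s ` B_pairs s"
      then obtain p where "x = glue s p" "p \<in> B_pairs s" by (rule imageE)
      then show "x \<in> B_affine q (s + 1) a b"
        using glue_mem_B_affine[of p s] by (simp add: B_pairs_def)
    qed
    show "B_affine q (s + 1) a b \<subseteq> glue s ` B_pairs s"
    proof
      fix x assume x: "x \<in> B_affine q (s + 1) a b"
      then have "x \<in> glue s ` (({..<s} \<rightarrow>\<^sub>E UNIV) \<times> UNIV)"
        using bij_glue by (simp add: bij_betw_def B_affine_def)
      then obtain p where "x = glue s p" "p \<in> ({..<s} \<rightarrow>\<^sub>E UNIV) \<times> UNIV" by (rule imageE)
      then show "x \<in> glue s ` B_pairs s"
        using x glue_mem_B_affine[of p s] by blast
    qed
  qed
  moreover have "inj_on (glue s) (B_pairs s)"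
    using bij_glue[of s] by (auto simp: bij_betw_def B_pairs_def intro: inj_on_subset)
  ultimately show ?thesis by (simp add: bij_betw_def)
qed

text \<open>The point set lies in no hyperplane, which supplies the nondegeneracy behind the
  dimension. For nonzero \<open>c\<close> there is at most one point for each of the
  \<open>q ^ (2 * s)\<close> choices of the first coordinates.\<close>

lemma zeros_less:
  assumes "c \<noteq> 0 \<or> c0 \<noteq> 0 \<or> (\<exists>i<s. m i \<noteq> 0)"
  shows "zeros s c0 m c < q ^ (2 * s + 1)"
proof (cases "c = 0")
  case True
  show ?thesis
  proof (cases "\<exists>i<s. m i \<noteq> 0")
    case True
    then obtain i where "i < s" "m i \<noteq> 0" by blast
    then have "zeros s c0 m c = q ^ (2 * s - 1)"
      using zeros_vertical \<open>c = 0\<close> by simp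
    then show ?thesis
      using q_gt_2 power_strict_increasing[of "2 * s - 1" "2 * s + 1" q] by simp
  next
    case False
    then have "(\<Sum>i<s. m i * fst p i) = 0" for p :: "(nat \<Rightarrow> 'a) \<times> 'a"
      by (intro sum.neutral) simp
    then have "zeros s c0 m c = 0"
      using assms \<open>c = 0\<close> False by (simp add: zeros_def)
    then show ?thesis using q_gt_2 by simp
  qed
next
  case False
  then have "zeros s c0 m c = hits s (- c0 / c) (\<lambda>i\<in>{..<s}. - m i / c)"
    by (rule zeros_graph)
  also have "\<dots> \<le> card ({..<s} \<rightarrow>\<^sub>E (UNIV :: 'a set))"
    unfolding hits_def by (rule card_mono) (auto simp: finite_PiE)
  also have "\<dots> = q ^ (2 * s)"
    by (simp add: card_funcsetE card_F power_mult)
  also have "\<dots> < q ^ (2 * s + 1)"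
    using q_gt_2 by simp
  finally show ?thesis .
qed

text \<open>Instantiates \<open>generated_code\<close> with representatives of leading coordinate 1.
  The chosen \<open>F\<close> converts a number of zeros into the monomial of the weight, so
  \<open>sum_zeros\<close> yields the enumerator.\<close>

lemma code_properties:
  assumes gen: "generates_code (s + 1) (B_set q (s + 1) a b) n C" and s: "s \<ge> 1"
  defines "F \<equiv> \<lambda>w. Polynomial.monom (1 :: int) (q ^ (2 * s + 1) - w)"
  shows "n = q ^ (2 * s + 1)" and "code_dim n C = s + 2" and "C \<subseteq> carrier_vec n"
    and "weight_enumerator n C
      = F (q ^ (2 * s + 1)) + of_nat (q ^ 2 - 1) * F 0
      + of_nat (q ^ 2 * (q ^ (2 * s) - 1) + (q ^ 2 - 1) * (q ^ 2 * q ^ s * (q ^ s - 1))) * F (q ^ (2 * s - 1))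
      + of_nat ((q ^ 2 - 1) * q ^ (s + 1)) * (\<Sum>\<kappa>\<in>K. F (q ^ s * nrep s \<kappa>))"
proof -
  let ?X = "vCons 1 ` B_affine q (s + 1) a b"
  let ?T = "{..<s} \<rightarrow>\<^sub>E (UNIV :: 'a set)"
  have B_set: "B_set q (s + 1) a b = proj_point ` ?X"
    by (auto simp: B_set_def)
  have bijX: "bij_betw (\<lambda>p. vCons 1 (glue s p)) (B_pairs s) ?X"
  proof -
    have "bij_betw (vCons 1) (B_affine q (s + 1) a b) ?X"
      by (rule inj_on_imp_bij_betw) (simp add: inj_on_def)
    then show ?thesis
      using bij_betw_trans[OF bij_glue_B] by (simp add: o_def)
  qed
  have count: "card {x \<in> ?X. vCons c0 (glue s (m, c)) \<bullet> x = 0} = zeros s c0 m c" for c0 m c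
    unfolding zeros_def
    by (rule card_filter_bij_betw[OF bijX, symmetric]) (simp add: glue_scalar_prod add.assoc)
  have sub: "?X \<subseteq> carrier_vec (s + 1 + 1)"
    by (auto simp: B_affine_def)
  \<comment> \<open>Two proportional vectors with leading coordinate 1 are equal.\<close>
  have inj: "inj_on proj_point ?X"
  proof (rule inj_onI)
    fix x y assume "x \<in> ?X" "y \<in> ?X" and eq: "proj_point x = proj_point y"
    then obtain x' y' where xy: "x = vCons 1 x'" "y = vCons 1 y'" by blast
    have "x \<in> proj_point y"
      using self_mem_proj_point[of x] eq by simp
    then obtain c where c: "x = c \<cdot>\<^sub>v y"
      by (auto simp: mem_proj_point)
    have "x $ 0 = c * y $ 0"
      unfolding c by (rule index_smult_vec) (simp add: xy)
    then have "c = 1"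
      by (simp add: xy)
    then show "x = y"
      using c by simp
  qed
  have nz: "0\<^sub>v (s + 1 + 1) \<notin> ?X"
    by (auto simp: zero_vec_Suc)
  have bijM: "bij_betw (\<lambda>(c0, p). vCons c0 (glue s p)) (UNIV \<times> (?T \<times> UNIV)) (carrier_vec (s + 1 + 1))"
  proof -
    have 1: "bij_betw (\<lambda>(c0, p). (c0, glue s p)) (UNIV \<times> (?T \<times> UNIV)) (UNIV \<times> carrier_vec (s + 1))"
      using bij_betw_map_prod[OF bij_betw_id bij_glue[of s]] by (simp add: map_prod_def id_def)
    have 2: "bij_betw (\<lambda>(c0 :: 'a, v). vCons c0 v) (UNIV \<times> carrier_vec (s + 1)) (carrier_vec (s + 1 + 1))"
    proof (rule bij_betw_byWitness[where f' = "\<lambda>v. (v $ 0, vec (s + 1) (\<lambda>i. v $ Suc i))"])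
      show "\<forall>p\<in>UNIV \<times> carrier_vec (s + 1). (\<lambda>v :: 'a vec. (v $ 0, vec (s + 1) (\<lambda>i. v $ Suc i)))
          ((\<lambda>(c0, v). vCons c0 v) p) = p"
        by (auto intro!: eq_vecI)
      show "\<forall>v\<in>carrier_vec (s + 1 + 1). (\<lambda>(c0 :: 'a, v). vCons c0 v) (v $ 0, vec (s + 1) (\<lambda>i. v $ Suc i)) = v"
        by (auto intro!: eq_vecI simp: vec_index_vCons)
    qed auto
    show ?thesis
      using bij_betw_trans[OF 1 2] unfolding o_def case_prod_beta fst_conv snd_conv .
  qed
  have nondeg: "v = 0\<^sub>v (s + 1 + 1)"
    if v: "v \<in> carrier_vec (s + 1 + 1)" and all: "\<And>x. x \<in> ?X \<Longrightarrow> v \<bullet> x = 0" for v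
  proof -
    have "v \<in> (\<lambda>(c0, p). vCons c0 (glue s p)) ` (UNIV \<times> (?T \<times> UNIV))"
      using v bijM by (simp add: bij_betw_def)
    then obtain c0 m c where v_eq: "v = vCons c0 (glue s (m, c))"
      by auto
    have "zeros s c0 m c = card ?X"
      unfolding count[symmetric] using all v_eq by (intro arg_cong[where f = card]) auto
    also have "\<dots> = q ^ (2 * s + 1)"
      using bij_betw_same_card[OF bijX] card_B_pairs by simp
    finally have "c = 0 \<and> c0 = 0 \<and> (\<forall>i<s. m i = 0)"
      using zeros_less[of c c0 s m] by fastforce
    moreover from this have "glue s (m, c) = 0\<^sub>v (Suc s)"
      by (intro eq_vecI) (auto simp: glue_def)
    ultimately show ?thesis
      by (simp add: v_eq zero_vec_Suc)
  qed
  note code = generated_code[OF gen[unfolded B_set] sub inj nz nondeg]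
  show n: "n = q ^ (2 * s + 1)"
    using code(1) bij_betw_same_card[OF bijX] card_B_pairs by simp
  show "code_dim n C = s + 2" "C \<subseteq> carrier_vec n"
    using code(2,3) by simp_all
  have "weight_enumerator n C = (\<Sum>v\<in>carrier_vec (s + 1 + 1). F (card {x \<in> ?X. v \<bullet> x = 0}))"
    using code(4) by (simp only: F_def n)
  also have "\<dots> = (\<Sum>p\<in>UNIV \<times> (?T \<times> UNIV). F (card {x \<in> ?X. (\<lambda>(c0, p). vCons c0 (glue s p)) p \<bullet> x = 0}))"
    by (rule sum.reindex_bij_betw[OF bijM, symmetric])
  also have "\<dots> = (\<Sum>(c0, m, c)\<in>UNIV \<times> (?T \<times> UNIV). F (zeros s c0 m c))"
  proof (rule sum.cong[OF refl])
    fix p :: "'a \<times> (nat \<Rightarrow> 'a) \<times> 'a"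
    obtain c0 m c where p: "p = (c0, m, c)" by (cases p)
    show "F (card {x \<in> ?X. (\<lambda>(c0, p). vCons c0 (glue s p)) p \<bullet> x = 0})
        = (case p of (c0, m, c) \<Rightarrow> F (zeros s c0 m c))"
      by (simp only: p prod.case count)
  qed
  also have "\<dots> = (\<Sum>c0\<in>UNIV. \<Sum>m\<in>?T. \<Sum>c\<in>UNIV. F (zeros s c0 m c))"
    by (simp only: sum.cartesian_product)
  also have "\<dots> = (\<Sum>c0\<in>UNIV. \<Sum>c\<in>UNIV. \<Sum>m\<in>?T. F (zeros s c0 m c))"
    by (rule sum.cong[OF refl], rule sum.swap)
  also have "\<dots> = (\<Sum>c\<in>UNIV. \<Sum>c0\<in>UNIV. \<Sum>m\<in>?T. F (zeros s c0 m c))"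
    by (rule sum.swap)
  finally show "weight_enumerator n C
      = F (q ^ (2 * s + 1)) + of_nat (q ^ 2 - 1) * F 0
      + of_nat (q ^ 2 * (q ^ (2 * s) - 1) + (q ^ 2 - 1) * (q ^ 2 * q ^ s * (q ^ s - 1))) * F (q ^ (2 * s - 1))
      + of_nat ((q ^ 2 - 1) * q ^ (s + 1)) * (\<Sum>\<kappa>\<in>K. F (q ^ s * nrep s \<kappa>))"
    by (simp only: sum_zeros[OF s])
qed

end

section \<open>From the sum over \<open>K\<close> to explicit monomials\<close>

lemma of_nat_mult_monom: "of_nat k * Polynomial.monom (c :: int) w = Polynomial.monom (int k * c) w"
  by (simp only: of_nat_monom mult_monom add_0)

text \<open>The exponents may coincide; positivity of the coefficients excludes cancellation in that
  case.\<close>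

lemma nonzero_weights:
  assumes C: "C \<subseteq> carrier_vec n"
    and W: "weight_enumerator n C = Polynomial.monom 1 0 + Polynomial.monom a1 w1
      + Polynomial.monom a2 w2 + Polynomial.monom a3 w3 + Polynomial.monom a4 w4"
    and pos: "a1 > 0" "a2 > 0" "a3 > 0" "a4 > 0"
    and nz: "w1 \<noteq> 0" "w2 \<noteq> 0" "w3 \<noteq> 0" "w4 \<noteq> 0"
  shows "{w. w \<noteq> 0 \<and> weight_count C w \<noteq> 0} = {w1, w2, w3, w4}"
proof -
  have count: "int (weight_count C w) = (if w1 = w then a1 else 0) + (if w2 = w then a2 else 0)
      + (if w3 = w then a3 else 0) + (if w4 = w then a4 else 0)" if "w \<noteq> 0" for w
    using that unfolding coeff_weight_enumerator[OF C, symmetric] W by simp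
  have "weight_count C w \<noteq> 0 \<longleftrightarrow> w \<in> {w1, w2, w3, w4}" if "w \<noteq> 0" for w
  proof -
    have "weight_count C w \<noteq> 0 \<longleftrightarrow> int (weight_count C w) \<noteq> 0"
      by simp
    also have "\<dots> \<longleftrightarrow> w1 = w \<or> w2 = w \<or> w3 = w \<or> w4 = w"
      unfolding count[OF that] using pos
      by (cases "w1 = w"; cases "w2 = w"; cases "w3 = w"; cases "w4 = w") simp_all
    finally show ?thesis by auto
  qed
  then show ?thesis
    using nz by blast
qed

context GF_square
begin

text \<open>The character vanishes once, and by \<open>sum_eta\<close> it takes the values 1 and
  \<open>- 1\<close> equally often.\<close>

lemma sum_by_eta:
  fixes \<Phi> :: "int \<Rightarrow> int poly"
  shows "(\<Sum>\<kappa>\<in>K. \<Phi> (eta \<kappa>)) = \<Phi> 0 + of_nat ((q - 1) div 2) * (\<Phi> 1 + \<Phi> (- 1))"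
proof -
  define P where "P = {\<kappa> \<in> K - {0}. eta \<kappa> = 1}"
  define M where "M = {\<kappa> \<in> K - {0}. eta \<kappa> = - 1}"
  have split: "K - {0} = P \<union> M"
  proof -
    have "eta \<kappa> = 1 \<or> eta \<kappa> = - 1" if "\<kappa> \<noteq> 0" for \<kappa>
      using that by (rule eta_cases) auto
    then show ?thesis unfolding P_def M_def by auto
  qed
  \<comment> \<open>Kept general in \<open>f\<close>: the identity and the constant 1 determine the
    sizes of \<open>P\<close> and \<open>M\<close>, and \<Phi> then gives the claim.\<close>
  have sums: "(\<Sum>\<kappa>\<in>K. f (eta \<kappa>)) = f 0 + (of_nat (card P) * f 1 + of_nat (card M) * f (- 1))"
    for f :: "int \<Rightarrow> 'b::comm_ring_1"
  proof -
    have "(\<Sum>\<kappa>\<in>K. f (eta \<kappa>)) = f (eta 0) + (\<Sum>\<kappa>\<in>K - {0}. f (eta \<kappa>))"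
      by (rule sum.remove) auto
    also have "(\<Sum>\<kappa>\<in>K - {0}. f (eta \<kappa>)) = (\<Sum>\<kappa>\<in>P. f (eta \<kappa>)) + (\<Sum>\<kappa>\<in>M. f (eta \<kappa>))"
      unfolding split by (rule sum.union_disjoint) (auto simp: P_def M_def)
    also have "(\<Sum>\<kappa>\<in>P. f (eta \<kappa>)) = of_nat (card P) * f 1"
      by (simp add: P_def)
    also have "(\<Sum>\<kappa>\<in>M. f (eta \<kappa>)) = of_nat (card M) * f (- 1)"
      by (simp add: M_def)
    finally show ?thesis by simp
  qed
  have "int (card P) = int (card M)"
    using sums[of "\<lambda>x. x"] sum_eta by simp
  moreover have "q = 1 + (card P + card M)"
    using sums[of "\<lambda>_. 1 :: int"] by (simp add: card_K)
  ultimately have "card P = (q - 1) div 2" "card M = (q - 1) div 2"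
    by linarith+
  then show ?thesis
    using sums[of \<Phi>] by (simp add: distrib_left)
qed

text \<open>The sign \<open>eta (- 1) ^ k\<close> merely exchanges two values taken equally often.
  This is why even \<open>r\<close> needs no distinction modulo 4.\<close>

lemma sum_nrep_odd:
  fixes F :: "nat \<Rightarrow> int poly"
  shows "(\<Sum>\<kappa>\<in>K. F (nrep (2 * k + 1) \<kappa>)) = F (q ^ (2 * k))
    + of_nat ((q - 1) div 2) * (F (q ^ (2 * k) + q ^ k) + F (q ^ (2 * k) - q ^ k))"
proof -
  let ?\<epsilon> = "eta (- 1) ^ k"
  have \<epsilon>: "?\<epsilon> = 1 \<or> ?\<epsilon> = - 1"
    using chi_q_mod_4 minus_one_power_iff[of k, where 'a = int] by auto
  let ?\<Phi> = "\<lambda>e. F (nat (int q ^ (2 * k) + ?\<epsilon> * int q ^ k * e))"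
  have "F (nrep (2 * k + 1) \<kappa>) = ?\<Phi> (eta \<kappa>)" if "\<kappa> \<in> K" for \<kappa>
    using nrep_odd_even(1)[OF that, of k] unfolding power_mult_distrib by (metis nat_int)
  then have "(\<Sum>\<kappa>\<in>K. F (nrep (2 * k + 1) \<kappa>)) = (\<Sum>\<kappa>\<in>K. ?\<Phi> (eta \<kappa>))"
    by (intro sum.cong) simp_all
  also have "\<dots> = ?\<Phi> 0 + of_nat ((q - 1) div 2) * (?\<Phi> 1 + ?\<Phi> (- 1))"
    by (rule sum_by_eta)
  also have "?\<Phi> 0 = F (q ^ (2 * k))"
    by (simp add: nat_power_eq)
  also have "?\<Phi> 1 + ?\<Phi> (- 1) = F (q ^ (2 * k) + q ^ k) + F (q ^ (2 * k) - q ^ k)"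
  proof -
    have plus: "nat (int q ^ (2 * k) + int q ^ k) = q ^ (2 * k) + q ^ k"
      by (simp add: nat_add_distrib nat_power_eq)
    have minus: "nat (int q ^ (2 * k) - int q ^ k) = q ^ (2 * k) - q ^ k"
      by (simp add: nat_diff_distrib' nat_power_eq)
    show ?thesis
      using \<epsilon> by (auto simp: plus minus add.commute[of "F (q ^ (2 * k) - q ^ k)"])
  qed
  finally show ?thesis .
qed

text \<open>The value at \<open>\<kappa> = 0\<close> occurs once and the other one
  \<open>q - 1\<close> times, so here the sign survives and causes the case distinction for odd
  \<open>r\<close>. The conversion \<open>nat\<close> accommodates both signs.\<close>

lemma sum_nrep_even:
  fixes F :: "nat \<Rightarrow> int poly"
  assumes "\<epsilon> = eta (- 1) ^ (k + 1)"
  shows "(\<Sum>\<kappa>\<in>K. F (nrep (2 * k + 2) \<kappa>))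
    = F (nat (int q ^ (2 * k + 1) + \<epsilon> * (int q ^ (k + 1) - int q ^ k)))
      + of_nat (q - 1) * F (nat (int q ^ (2 * k + 1) - \<epsilon> * int q ^ k))"
proof -
  let ?v = "\<lambda>e. nat (int q ^ (2 * k + 1) + \<epsilon> * int q ^ k * (int q * e - 1))"
  have v: "nrep (2 * k + 2) \<kappa> = ?v (of_bool (\<kappa> = 0))" if "\<kappa> \<in> K" for \<kappa>
  proof -
    have "int (nrep (2 * k + 2) \<kappa>)
        = int q ^ (2 * k + 1) + \<epsilon> * int q ^ k * (int q * of_bool (\<kappa> = 0) - 1)"
      unfolding nrep_odd_even(2)[OF that] assms by (simp add: power_mult_distrib mult_ac)
    then show ?thesis by (metis nat_int)
  qed
  have "(\<Sum>\<kappa>\<in>K. F (nrep (2 * k + 2) \<kappa>))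
      = F (nrep (2 * k + 2) 0) + (\<Sum>\<kappa>\<in>K - {0}. F (nrep (2 * k + 2) \<kappa>))"
    by (rule sum.remove) auto
  also have "nrep (2 * k + 2) 0 = ?v 1"
    using v[of 0] by simp
  also have "(\<Sum>\<kappa>\<in>K - {0}. F (nrep (2 * k + 2) \<kappa>)) = (\<Sum>\<kappa>\<in>K - {0}. F (?v 0))"
    using v by (intro sum.cong) auto
  also have "\<dots> = of_nat (q - 1) * F (?v 0)"
    using card_Diff_singleton[OF K_0] by (simp add: card_K)
  finally show ?thesis
    by (simp add: algebra_simps)
qed

end

text \<open>For even \<open>r\<close> the tangent hyperplanes with \<open>\<kappa> = 0\<close> yield
  the same weight as the generic ones, so their coefficients merge into that of
  \<open>MA\<close>.\<close>

lemma assemble_even: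
  fixes M0 M1 MA P Q :: "int poly"
  shows "M0 + of_nat u * M1 + of_nat c1 * MA + of_nat c2 * (MA + of_nat m * (P + Q))
    = M0 + of_nat u * M1 + of_nat (c2 * m) * Q + of_nat (c2 * m) * P + of_nat (c1 + c2) * MA"
  by (simp add: algebra_simps)

lemma assemble_odd:
  fixes M0 M1 MA P Q :: "int poly"
  shows "M0 + of_nat u * M1 + of_nat c1 * MA + of_nat c2 * (P + of_nat m * Q)
    = M0 + of_nat u * M1 + of_nat c2 * P + of_nat c1 * MA + of_nat (c2 * m) * Q"
  by (simp add: algebra_simps)

section \<open>Explicit enumerators for even and for odd \<open>r\<close>\<close>

context quasi_hermitian_basis
begin

lemma enumerator_even:
  assumes gen: "generates_code (2 * k + 2) (B_set q (2 * k + 2) a b) n C"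
  shows "n = q ^ (4 * k + 3)" and "code_dim n C = 2 * k + 3" and "C \<subseteq> carrier_vec n"
    and "weight_enumerator n C = Polynomial.monom 1 0
      + Polynomial.monom (int q ^ 2 - 1) (q ^ (4 * k + 3))
      + Polynomial.monom ((int q ^ (2 * k + 3) - int q ^ (2 * k + 2)) * (int q ^ 2 - 1) div 2)
          (q ^ (4 * k + 3) - q ^ (4 * k + 1) + q ^ (3 * k + 1))
      + Polynomial.monom ((int q ^ (2 * k + 3) - int q ^ (2 * k + 2)) * (int q ^ 2 - 1) div 2)
          (q ^ (4 * k + 3) - q ^ (4 * k + 1) - q ^ (3 * k + 1))
      + Polynomial.monom (int q ^ (2 * (2 * k + 2)) + int q ^ (2 * k + 4) - int q ^ (2 * k + 2) - int q ^ 2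
            + (int q ^ (2 * (2 * k + 2)) - int q ^ (2 * k + 3)) * (int q ^ 2 - 1))
          (q ^ (4 * k + 3) - q ^ (4 * k + 1))"
proof -
  define s where "s = 2 * k + 1"
  have gen': "generates_code (s + 1) (B_set q (s + 1) a b) n C" and s1: "s \<ge> 1"
    using gen by (simp_all add: s_def)
  have s_exp: "2 * s + 1 = 4 * k + 3" "2 * s - 1 = 4 * k + 1" "s + 2 = 2 * k + 3"
    by (simp_all add: s_def)
  note code = code_properties[OF gen' s1, unfolded s_exp]
  show n: "n = q ^ (4 * k + 3)" and "code_dim n C = 2 * k + 3" and "C \<subseteq> carrier_vec n"
    by (fact code)+
  define m where "m = (q - 1) div 2"
  have q: "q = 2 * m + 1"
    using q_odd by (auto simp: m_def elim: oddE)
  \<comment> \<open>With this power as an atom, the coefficient identities become polynomial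
    identities in \<open>X\<close> and \<open>q\<close>.\<close>
  define X where "X = int q ^ (2 * k)"
  have pow: "int q ^ (2 * k + i) = X * int q ^ i" for i
    by (simp add: X_def power_add)
  have "2 * (2 * k + 2) = 2 * k + (2 * k + 4)"
    by simp
  then have pow': "int q ^ (2 * (2 * k + 2)) = X * (X * int q ^ 4)"
    by (simp only: pow)
  let ?F = "\<lambda>w. Polynomial.monom (1 :: int) (q ^ (4 * k + 3) - w)"
  let ?c1 = "q ^ 2 * (q ^ (2 * s) - 1) + (q ^ 2 - 1) * (q ^ 2 * q ^ s * (q ^ s - 1))"
  let ?c2 = "(q ^ 2 - 1) * q ^ (s + 1)"
  have A: "q ^ s * q ^ (2 * k) = q ^ (4 * k + 1)" "q ^ s * q ^ k = q ^ (3 * k + 1)"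
    by (simp_all add: s_def flip: power_add)
  have "(\<Sum>\<kappa>\<in>K. ?F (q ^ s * nrep s \<kappa>)) = ?F (q ^ s * q ^ (2 * k))
    + of_nat m * (?F (q ^ s * (q ^ (2 * k) + q ^ k)) + ?F (q ^ s * (q ^ (2 * k) - q ^ k)))"
    unfolding s_def m_def by (rule sum_nrep_odd[where F = "\<lambda>w. ?F (q ^ (2 * k + 1) * w)"])
  then have sum: "(\<Sum>\<kappa>\<in>K. ?F (q ^ s * nrep s \<kappa>)) = ?F (q ^ (4 * k + 1))
    + of_nat m * (?F (q ^ (4 * k + 1) + q ^ (3 * k + 1)) + ?F (q ^ (4 * k + 1) - q ^ (3 * k + 1)))"
    by (simp only: distrib_left diff_mult_distrib2 A)
  have W: "weight_enumerator n C = Polynomial.monom 1 0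
      + Polynomial.monom (int (q ^ 2 - 1)) (q ^ (4 * k + 3))
      + Polynomial.monom (int (?c2 * m)) (q ^ (4 * k + 3) - (q ^ (4 * k + 1) - q ^ (3 * k + 1)))
      + Polynomial.monom (int (?c2 * m)) (q ^ (4 * k + 3) - (q ^ (4 * k + 1) + q ^ (3 * k + 1)))
      + Polynomial.monom (int (?c1 + ?c2)) (q ^ (4 * k + 3) - q ^ (4 * k + 1))"
    unfolding code(4) sum assemble_even
    by (simp only: of_nat_mult_monom mult_1_right diff_self_eq_0 diff_zero)
  \<comment> \<open>Weights are natural numbers, so these bounds are needed to regroup the
    subtractions.\<close>
  have le: "q ^ (3 * k + 1) \<le> q ^ (4 * k + 1)" "q ^ (4 * k + 1) \<le> q ^ (4 * k + 3)"
    by (rule power_increasing; use q_gt_2 in simp)+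
  have q2: "int (q ^ 2 - 1) = int q ^ 2 - 1"
    using q_gt_2 by (simp add: of_nat_diff)
  have qi: "int (q ^ i - 1) = int q ^ i - 1" for i
    using q_gt_2 by (simp add: of_nat_diff)
  have c2: "int ?c2 = (int q ^ 2 - 1) * (X * int q ^ 2)"
    unfolding of_nat_mult qi by (simp add: s_def pow[of 2, simplified])
  \<comment> \<open>The division by 2 is exact because the coefficient contains the factor
    \<open>q - 1 = 2 * m\<close>.\<close>
  have "int q = 2 * int m + 1"
    using q by simp
  then have "(int q ^ (2 * k + 3) - int q ^ (2 * k + 2)) * (int q ^ 2 - 1) = 2 * int (?c2 * m)"
    unfolding of_nat_mult[of ?c2 m] c2 pow by (simp add: algebra_simps power2_eq_square power3_eq_cube)
  then have c2m: "int (?c2 * m) = (int q ^ (2 * k + 3) - int q ^ (2 * k + 2)) * (int q ^ 2 - 1) div 2"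
    by simp
  have c1: "int (?c1 + ?c2) = int q ^ (2 * (2 * k + 2)) + int q ^ (2 * k + 4) - int q ^ (2 * k + 2) - int q ^ 2
            + (int q ^ (2 * (2 * k + 2)) - int q ^ (2 * k + 3)) * (int q ^ 2 - 1)"
  proof -
    have "2 * s = 2 * k + (2 * k + 2)" "s = 2 * k + 1"
      by (simp_all add: s_def)
    then have "int q ^ (2 * s) = X * (X * int q ^ 2)" "int q ^ s = X * int q ^ 1"
      by (simp_all only: pow)
    then show ?thesis
      unfolding of_nat_add c2 unfolding of_nat_mult of_nat_power qi pow' pow
      by (simp add: algebra_simps power2_eq_square power3_eq_cube power4_eq_xxxx)
  qed
  have w: "q ^ (4 * k + 3) - (q ^ (4 * k + 1) - q ^ (3 * k + 1)) = q ^ (4 * k + 3) - q ^ (4 * k + 1) + q ^ (3 * k + 1)"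
    "q ^ (4 * k + 3) - (q ^ (4 * k + 1) + q ^ (3 * k + 1)) = q ^ (4 * k + 3) - q ^ (4 * k + 1) - q ^ (3 * k + 1)"
    using le by linarith+
  show "weight_enumerator n C = Polynomial.monom 1 0
      + Polynomial.monom (int q ^ 2 - 1) (q ^ (4 * k + 3))
      + Polynomial.monom ((int q ^ (2 * k + 3) - int q ^ (2 * k + 2)) * (int q ^ 2 - 1) div 2)
          (q ^ (4 * k + 3) - q ^ (4 * k + 1) + q ^ (3 * k + 1))
      + Polynomial.monom ((int q ^ (2 * k + 3) - int q ^ (2 * k + 2)) * (int q ^ 2 - 1) div 2)
          (q ^ (4 * k + 3) - q ^ (4 * k + 1) - q ^ (3 * k + 1))
      + Polynomial.monom (int q ^ (2 * (2 * k + 2)) + int q ^ (2 * k + 4) - int q ^ (2 * k + 2) - int q ^ 2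
            + (int q ^ (2 * (2 * k + 2)) - int q ^ (2 * k + 3)) * (int q ^ 2 - 1))
          (q ^ (4 * k + 3) - q ^ (4 * k + 1))"
    unfolding W w c1 c2m q2 ..
qed

lemma enumerator_odd:
  assumes gen: "generates_code (2 * k + 3) (B_set q (2 * k + 3) a b) n C"
  shows "n = q ^ (4 * k + 5)" and "code_dim n C = 2 * k + 4" and "C \<subseteq> carrier_vec n"
    and "eta (- 1) ^ (k + 1) = 1 \<Longrightarrow> weight_enumerator n C = Polynomial.monom 1 0
      + Polynomial.monom (int q ^ 2 - 1) (q ^ (4 * k + 5))
      + Polynomial.monom (int q ^ (2 * k + 5) - int q ^ (2 * k + 3))
          (q ^ (4 * k + 5) - q ^ (4 * k + 3) - q ^ (3 * k + 3) + q ^ (3 * k + 2))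
      + Polynomial.monom (int q ^ (2 * (2 * k + 3)) - int q ^ 2
            + (int q ^ (2 * (2 * k + 3)) - int q ^ (2 * k + 4)) * (int q ^ 2 - 1))
          (q ^ (4 * k + 5) - q ^ (4 * k + 3))
      + Polynomial.monom ((int q ^ (2 * k + 4) - int q ^ (2 * k + 3)) * (int q ^ 2 - 1))
          (q ^ (4 * k + 5) - q ^ (4 * k + 3) + q ^ (3 * k + 2))"
    and "eta (- 1) ^ (k + 1) = - 1 \<Longrightarrow> weight_enumerator n C = Polynomial.monom 1 0
      + Polynomial.monom (int q ^ 2 - 1) (q ^ (4 * k + 5))
      + Polynomial.monom ((int q ^ (2 * k + 4) - int q ^ (2 * k + 3)) * (int q ^ 2 - 1))
          (q ^ (4 * k + 5) - q ^ (4 * k + 3) - q ^ (3 * k + 2))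
      + Polynomial.monom (int q ^ (2 * (2 * k + 3)) - int q ^ 2
            + (int q ^ (2 * (2 * k + 3)) - int q ^ (2 * k + 4)) * (int q ^ 2 - 1))
          (q ^ (4 * k + 5) - q ^ (4 * k + 3))
      + Polynomial.monom (int q ^ (2 * k + 5) - int q ^ (2 * k + 3))
          (q ^ (4 * k + 5) - q ^ (4 * k + 3) + q ^ (3 * k + 3) - q ^ (3 * k + 2))"
proof -
  define s where "s = 2 * k + 2"
  have "s + 1 = 2 * k + 3"
    by (simp add: s_def)
  then have gen': "generates_code (s + 1) (B_set q (s + 1) a b) n C"
    using gen by (simp only:)
  have s1: "s \<ge> 1"
    by (simp add: s_def)
  have s_exp: "2 * s + 1 = 4 * k + 5" "2 * s - 1 = 4 * k + 3" "s + 2 = 2 * k + 4"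
    by (simp_all add: s_def)
  note code = code_properties[OF gen' s1, unfolded s_exp]
  show n: "n = q ^ (4 * k + 5)" and "code_dim n C = 2 * k + 4" and "C \<subseteq> carrier_vec n"
    by (fact code)+
  define X where "X = int q ^ (2 * k)"
  have pow: "int q ^ (2 * k + i) = X * int q ^ i" for i
    by (simp add: X_def power_add)
  have "2 * (2 * k + 3) = 2 * k + (2 * k + 6)"
    by simp
  then have pow': "int q ^ (2 * (2 * k + 3)) = X * (X * int q ^ 6)"
    by (simp only: pow)
  let ?F = "\<lambda>w. Polynomial.monom (1 :: int) (q ^ (4 * k + 5) - w)"
  let ?c1 = "q ^ 2 * (q ^ (2 * s) - 1) + (q ^ 2 - 1) * (q ^ 2 * q ^ s * (q ^ s - 1))"
  let ?c2 = "(q ^ 2 - 1) * q ^ (s + 1)"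
  have A: "q ^ s * q ^ (2 * k + 1) = q ^ (4 * k + 3)" "q ^ s * q ^ (k + 1) = q ^ (3 * k + 3)"
    "q ^ s * q ^ k = q ^ (3 * k + 2)"
    by (simp_all only: s_def power_add[symmetric]) (rule arg_cong[where f = "(^) q"], simp)+
  have sum: "(\<Sum>\<kappa>\<in>K. ?F (q ^ s * nrep s \<kappa>))
      = ?F (q ^ s * nat (int q ^ (2 * k + 1) + \<epsilon> * (int q ^ (k + 1) - int q ^ k)))
        + of_nat (q - 1) * ?F (q ^ s * nat (int q ^ (2 * k + 1) - \<epsilon> * int q ^ k))"
    if "\<epsilon> = eta (- 1) ^ (k + 1)" for \<epsilon>
    using sum_nrep_even[OF that, where F = "\<lambda>w. ?F (q ^ s * w)"] unfolding s_def .
  have W: "weight_enumerator n C = Polynomial.monom 1 0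
      + Polynomial.monom (int (q ^ 2 - 1)) (q ^ (4 * k + 5))
      + Polynomial.monom (int ?c2)
          (q ^ (4 * k + 5) - q ^ s * nat (int q ^ (2 * k + 1) + \<epsilon> * (int q ^ (k + 1) - int q ^ k)))
      + Polynomial.monom (int ?c1) (q ^ (4 * k + 5) - q ^ (4 * k + 3))
      + Polynomial.monom (int (?c2 * (q - 1)))
          (q ^ (4 * k + 5) - q ^ s * nat (int q ^ (2 * k + 1) - \<epsilon> * int q ^ k))"
    if "\<epsilon> = eta (- 1) ^ (k + 1)" for \<epsilon>
    unfolding code(4) sum[OF that] assemble_odd
    by (simp only: of_nat_mult_monom mult_1_right diff_self_eq_0 diff_zero)
  have le: "q ^ (3 * k + 2) \<le> q ^ (3 * k + 3)" "q ^ (3 * k + 3) \<le> q ^ (4 * k + 3)"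
      "q ^ k \<le> q ^ (k + 1)" "q ^ (k + 1) \<le> q ^ (2 * k + 1)"
    by (rule power_increasing; use q_gt_2 in simp)+
  \<comment> \<open>Leads to \<open>le2\<close>, which keeps the subtractions in the weights from
    being truncated at 0.\<close>
  have "2 * 1 \<le> q * q"
    by (rule mult_le_mono; use q_gt_2 in simp)
  then have "2 \<le> q ^ 2"
    by (simp add: power2_eq_square)
  then have "2 * q ^ (4 * k + 3) \<le> q ^ 2 * q ^ (4 * k + 3)"
    by (intro mult_right_mono) auto
  also have "\<dots> = q ^ (4 * k + 5)"
    by (simp only: power_add[symmetric]) (rule arg_cong[where f = "(^) q"], simp)
  finally have le2: "2 * q ^ (4 * k + 3) \<le> q ^ (4 * k + 5)" .
  have qi: "int (q ^ i - 1) = int q ^ i - 1" for i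
    using q_gt_2 by (simp add: of_nat_diff)
  have c2: "int ?c2 = int q ^ (2 * k + 5) - int q ^ (2 * k + 3)"
    unfolding of_nat_mult qi of_nat_power \<open>s + 1 = 2 * k + 3\<close> pow
    by (simp add: algebra_simps eval_nat_numeral)
  have c2': "int (?c2 * (q - 1)) = (int q ^ (2 * k + 4) - int q ^ (2 * k + 3)) * (int q ^ 2 - 1)"
  proof -
    have "int (q - 1) = int q - 1"
      using q_gt_2 by simp
    then show ?thesis
      unfolding of_nat_mult[of ?c2] c2 unfolding pow
      by (simp add: algebra_simps power2_eq_square power3_eq_cube power4_eq_xxxx eval_nat_numeral)
  qed
  have c1: "int ?c1 = int q ^ (2 * (2 * k + 3)) - int q ^ 2
            + (int q ^ (2 * (2 * k + 3)) - int q ^ (2 * k + 4)) * (int q ^ 2 - 1)"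
  proof -
    have "2 * s = 2 * k + (2 * k + 4)" "s = 2 * k + 2"
      by (simp_all add: s_def)
    then have "int q ^ (2 * s) = X * (X * int q ^ 4)" "int q ^ s = X * int q ^ 2"
      by (simp_all only: pow)
    then show ?thesis
      unfolding of_nat_add of_nat_mult of_nat_power qi pow' pow
      by (simp add: algebra_simps eval_nat_numeral)
  qed
  \<comment> \<open>To be read with \<open>x = q ^ (2 * k + 1)\<close>,
    \<open>y = q ^ (k + 1)\<close> and \<open>z = q ^ k\<close>; the order of these powers makes all
    signed expressions nonnegative.\<close>
  have nats: "nat (int x + (int y - int z)) = x + (y - z)" "nat (int x - int z) = x - z"
      "nat (int x - (int y - int z)) = x - (y - z)" "nat (int x + int z) = x + z"
    if "z \<le> y" "y \<le> x" for x y z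
    using that by linarith+
  show "weight_enumerator n C = Polynomial.monom 1 0
      + Polynomial.monom (int q ^ 2 - 1) (q ^ (4 * k + 5))
      + Polynomial.monom (int q ^ (2 * k + 5) - int q ^ (2 * k + 3))
          (q ^ (4 * k + 5) - q ^ (4 * k + 3) - q ^ (3 * k + 3) + q ^ (3 * k + 2))
      + Polynomial.monom (int q ^ (2 * (2 * k + 3)) - int q ^ 2
            + (int q ^ (2 * (2 * k + 3)) - int q ^ (2 * k + 4)) * (int q ^ 2 - 1))
          (q ^ (4 * k + 5) - q ^ (4 * k + 3))
      + Polynomial.monom ((int q ^ (2 * k + 4) - int q ^ (2 * k + 3)) * (int q ^ 2 - 1))
          (q ^ (4 * k + 5) - q ^ (4 * k + 3) + q ^ (3 * k + 2))"
    if \<epsilon>: "eta (- 1) ^ (k + 1) = 1"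
  proof -
    have "q ^ s * nat (int q ^ (2 * k + 1) + 1 * (int q ^ (k + 1) - int q ^ k))
        = q ^ (4 * k + 3) + (q ^ (3 * k + 3) - q ^ (3 * k + 2))"
      "q ^ s * nat (int q ^ (2 * k + 1) - 1 * int q ^ k) = q ^ (4 * k + 3) - q ^ (3 * k + 2)"
      unfolding of_nat_power[symmetric] mult_1_left nats[OF le(3,4)] distrib_left diff_mult_distrib2 A
      by (rule refl)+
    moreover have "q ^ (4 * k + 5) - (q ^ (4 * k + 3) + (q ^ (3 * k + 3) - q ^ (3 * k + 2)))
        = q ^ (4 * k + 5) - q ^ (4 * k + 3) - q ^ (3 * k + 3) + q ^ (3 * k + 2)"
      "q ^ (4 * k + 5) - (q ^ (4 * k + 3) - q ^ (3 * k + 2))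
        = q ^ (4 * k + 5) - q ^ (4 * k + 3) + q ^ (3 * k + 2)"
      using le(1,2) le2 by linarith+
    ultimately show ?thesis
      unfolding W[OF \<epsilon>[symmetric]] c1 c2 c2' qi by (simp only:)
  qed
  show "weight_enumerator n C = Polynomial.monom 1 0
      + Polynomial.monom (int q ^ 2 - 1) (q ^ (4 * k + 5))
      + Polynomial.monom ((int q ^ (2 * k + 4) - int q ^ (2 * k + 3)) * (int q ^ 2 - 1))
          (q ^ (4 * k + 5) - q ^ (4 * k + 3) - q ^ (3 * k + 2))
      + Polynomial.monom (int q ^ (2 * (2 * k + 3)) - int q ^ 2
            + (int q ^ (2 * (2 * k + 3)) - int q ^ (2 * k + 4)) * (int q ^ 2 - 1))
          (q ^ (4 * k + 5) - q ^ (4 * k + 3))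
      + Polynomial.monom (int q ^ (2 * k + 5) - int q ^ (2 * k + 3))
          (q ^ (4 * k + 5) - q ^ (4 * k + 3) + q ^ (3 * k + 3) - q ^ (3 * k + 2))"
    if \<epsilon>: "eta (- 1) ^ (k + 1) = - 1"
  proof -
    have "q ^ s * nat (int q ^ (2 * k + 1) + - 1 * (int q ^ (k + 1) - int q ^ k))
        = q ^ (4 * k + 3) - (q ^ (3 * k + 3) - q ^ (3 * k + 2))"
      "q ^ s * nat (int q ^ (2 * k + 1) - - 1 * int q ^ k) = q ^ (4 * k + 3) + q ^ (3 * k + 2)"
      unfolding of_nat_power[symmetric] mult_minus1 diff_conv_add_uminus[symmetric] diff_minus_eq_add
        nats[OF le(3,4)] distrib_left diff_mult_distrib2 A
      by (rule refl)+
    moreover have "q ^ (4 * k + 5) - (q ^ (4 * k + 3) - (q ^ (3 * k + 3) - q ^ (3 * k + 2)))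
        = q ^ (4 * k + 5) - q ^ (4 * k + 3) + q ^ (3 * k + 3) - q ^ (3 * k + 2)"
      "q ^ (4 * k + 5) - (q ^ (4 * k + 3) + q ^ (3 * k + 2))
        = q ^ (4 * k + 5) - q ^ (4 * k + 3) - q ^ (3 * k + 2)"
      using le(1,2) le2 by linarith+
    ultimately show ?thesis
      unfolding W[OF \<epsilon>[symmetric]] c1 c2 c2' qi
      by (simp only:)
  qed
qed

end

section \<open>The number of nonzero weights\<close>

lemma card_3_distinct:
  "x \<noteq> y \<Longrightarrow> x \<noteq> z \<Longrightarrow> y \<noteq> z \<Longrightarrow> card {x, y, z} = 3"
  by simp

lemma card_4_distinct:
  "w \<noteq> x \<Longrightarrow> w \<noteq> y \<Longrightarrow> w \<noteq> z \<Longrightarrow> x \<noteq> y \<Longrightarrow> x \<noteq> z \<Longrightarrow> y \<noteq> z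
    \<Longrightarrow> card {w, x, y, z} = 4"
  by simp

context quasi_hermitian_basis
begin

lemma pow_mono: "i < j \<Longrightarrow> q ^ i < q ^ j" "i \<le> j \<Longrightarrow> q ^ i \<le> q ^ j"
  using q_gt_2 by (simp_all add: power_strict_increasing power_increasing)

lemma int_pow_mono: "i < j \<Longrightarrow> int q ^ i < int q ^ j" "i \<le> j \<Longrightarrow> int q ^ i \<le> int q ^ j"
  using pow_mono[of i j] by (simp_all flip: of_nat_power)

lemma int_q2: "int q ^ 2 - 1 > 0"
  using int_pow_mono(1)[of 0 2] by simp

text \<open>Separates the length from the correction terms: with \<open>e \<le> A\<close> and
  \<open>3 * A \<le> N\<close>, even \<open>N - A - e\<close> is a positive weight.\<close>

lemma three_pow_le:
  assumes "j = i + 2"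
  shows "3 * q ^ i \<le> q ^ j"
proof -
  have "3 * 1 \<le> q * q"
    by (rule mult_le_mono) (use q_gt_2 in simp_all)
  then have "3 \<le> q ^ 2"
    by (simp add: power2_eq_square)
  then have "q ^ i * 3 \<le> q ^ i * q ^ 2"
    by (rule mult_left_mono) simp
  then show ?thesis
    by (simp only: assms power_add mult.commute[of 3])
qed

text \<open>For \<open>k = 0\<close> the correction \<open>e\<close> equals \<open>A\<close>, so the
  weight \<open>N - A + e\<close> is the full length \<open>N\<close> and only three weights remain;
  for larger \<open>k\<close> it is strictly smaller.\<close>

lemma card_weights_even:
  assumes gen: "generates_code (2 * k + 2) (B_set q (2 * k + 2) a b) n C"
  shows "card {w. w \<noteq> 0 \<and> weight_count C w \<noteq> 0} = (if k = 0 then 3 else 4)"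
proof -
  define N A e where "N = q ^ (4 * k + 3)" and "A = q ^ (4 * k + 1)" and "e = q ^ (3 * k + 1)"
  note enum = enumerator_even[OF gen]
  have e0: "e > 0"
    unfolding e_def using q_gt_2 by simp
  have eA: "e \<le> A" and eA': "k \<noteq> 0 \<Longrightarrow> e < A"
    unfolding e_def A_def by (rule pow_mono; simp)+
  have N: "3 * A \<le> N"
    unfolding N_def A_def by (rule three_pow_le) simp
  let ?a3 = "(int q ^ (2 * k + 3) - int q ^ (2 * k + 2)) * (int q ^ 2 - 1) div 2"
  let ?a2 = "int q ^ (2 * (2 * k + 2)) + int q ^ (2 * k + 4) - int q ^ (2 * k + 2) - int q ^ 2
            + (int q ^ (2 * (2 * k + 2)) - int q ^ (2 * k + 3)) * (int q ^ 2 - 1)"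
  have a3: "?a3 > 0"
  proof -
    have "1 \<le> int q ^ (2 * k + 3) - int q ^ (2 * k + 2)"
      using int_pow_mono(1)[of "2 * k + 2" "2 * k + 3"] by linarith
    moreover have "2 \<le> int q ^ 2 - 1"
      using three_pow_le[of 2 0] by (simp flip: of_nat_power)
    ultimately have "1 * 2 \<le> (int q ^ (2 * k + 3) - int q ^ (2 * k + 2)) * (int q ^ 2 - 1)"
      by (intro mult_mono) auto
    then show ?thesis
      by linarith
  qed
  have a2: "?a2 > 0"
  proof -
    have "int q ^ (2 * k + 3) \<le> int q ^ (2 * (2 * k + 2))"
      by (rule int_pow_mono) simp
    then have "0 \<le> (int q ^ (2 * (2 * k + 2)) - int q ^ (2 * k + 3)) * (int q ^ 2 - 1)"
      using int_q2 by (intro mult_nonneg_nonneg; linarith)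
    moreover have "int q ^ 2 < int q ^ (2 * (2 * k + 2))" "int q ^ (2 * k + 2) < int q ^ (2 * k + 4)"
      by (rule int_pow_mono; simp)+
    ultimately show ?thesis
      by linarith
  qed
  have "{w. w \<noteq> 0 \<and> weight_count C w \<noteq> 0} = {N, N - A + e, N - A - e, N - A}"
    using e0 eA N by (intro nonzero_weights[OF enum(3) enum(4)[folded N_def A_def e_def] int_q2 a3 a3 a2]) auto
  also have "card \<dots> = (if k = 0 then 3 else 4)"
  proof (cases "k = 0")
    case True
    then have "e = A"
      by (simp add: e_def A_def)
    then have "{N, N - A + e, N - A - e, N - A} = {N, N - A - e, N - A}"
      using N by auto
    moreover have "card {N, N - A - e, N - A} = 3"
      using e0 eA N by (intro card_3_distinct; linarith)
    ultimately show ?thesis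
      using True by simp
  next
    case False
    moreover have "card {N, N - A + e, N - A - e, N - A} = 4"
      using e0 eA'[OF False] N by (intro card_4_distinct; linarith)
    ultimately show ?thesis
      by simp
  qed
  finally show ?thesis .
qed

text \<open>No coincidence occurs, not even for \<open>k = 0\<close> where \<open>E = A\<close>:
  both \<open>e\<close> and \<open>E - e\<close> lie strictly between 0 and \<open>A\<close>, so the
  upper weight stays below \<open>N\<close>.\<close>

lemma card_weights_odd:
  assumes gen: "generates_code (2 * k + 3) (B_set q (2 * k + 3) a b) n C"
  shows "card {w. w \<noteq> 0 \<and> weight_count C w \<noteq> 0} = 4"
proof -
  define N A E e where "N = q ^ (4 * k + 5)" and "A = q ^ (4 * k + 3)"
    and "E = q ^ (3 * k + 3)" and "e = q ^ (3 * k + 2)"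
  note enum = enumerator_odd[OF gen]
  have e0: "e > 0"
    unfolding e_def using q_gt_2 by simp
  have eE: "e < E" and EA: "E \<le> A"
    unfolding e_def E_def A_def by (rule pow_mono; simp)+
  have N: "3 * A \<le> N"
    unfolding N_def A_def by (rule three_pow_le) simp
  let ?a3 = "int q ^ (2 * k + 5) - int q ^ (2 * k + 3)"
  let ?a4 = "(int q ^ (2 * k + 4) - int q ^ (2 * k + 3)) * (int q ^ 2 - 1)"
  let ?a2 = "int q ^ (2 * (2 * k + 3)) - int q ^ 2
            + (int q ^ (2 * (2 * k + 3)) - int q ^ (2 * k + 4)) * (int q ^ 2 - 1)"
  have a3: "?a3 > 0"
    using int_pow_mono(1)[of "2 * k + 3" "2 * k + 5"] by linarith
  have a4: "?a4 > 0"
    using int_pow_mono(1)[of "2 * k + 3" "2 * k + 4"] int_q2 by (intro mult_pos_pos) auto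
  have a2: "?a2 > 0"
  proof -
    have "int q ^ (2 * k + 4) \<le> int q ^ (2 * (2 * k + 3))"
      by (rule int_pow_mono) simp
    then have "0 \<le> (int q ^ (2 * (2 * k + 3)) - int q ^ (2 * k + 4)) * (int q ^ 2 - 1)"
      using int_q2 by (intro mult_nonneg_nonneg; linarith)
    moreover have "int q ^ 2 < int q ^ (2 * (2 * k + 3))"
      by (rule int_pow_mono) simp
    ultimately show ?thesis
      by linarith
  qed
  have "eta (- 1) ^ (k + 1) = 1 \<or> eta (- 1) ^ (k + 1) = - 1"
    using chi_q_mod_4 minus_one_power_iff[of "k + 1", where 'a = int] by auto
  then show ?thesis
  proof
    assume "eta (- 1) ^ (k + 1) = 1"
    note W = enum(4)[OF this, folded N_def A_def E_def e_def]
    have "{w. w \<noteq> 0 \<and> weight_count C w \<noteq> 0} = {N, N - A - E + e, N - A, N - A + e}"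
      using e0 eE EA N by (intro nonzero_weights[OF enum(3) W int_q2 a3 a2 a4]) auto
    also have "card \<dots> = 4"
      using e0 eE EA N by (intro card_4_distinct; linarith)
    finally show ?thesis .
  next
    assume "eta (- 1) ^ (k + 1) = - 1"
    note W = enum(5)[OF this, folded N_def A_def E_def e_def]
    have "{w. w \<noteq> 0 \<and> weight_count C w \<noteq> 0} = {N, N - A - e, N - A, N - A + E - e}"
      using e0 eE EA N by (intro nonzero_weights[OF enum(3) W int_q2 a4 a2 a3]) auto
    also have "card \<dots> = 4"
      using e0 eE EA N by (intro card_4_distinct; linarith)
    finally show ?thesis .
  qed
qed

end

text \<open>Enumerators are written as sums of monomials, so equal exponents add up. This happens
  for \<open>r = 2\<close>, where the weight with the positive correction is the length itself; the
  last conjunct therefore gives three nonzero weights there instead of four.\<close>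

theorem theorem4p1:
  fixes a b :: "'a::{field,finite}" and q r n :: nat and C :: "'a vec set"
  assumes "primepow q" and "odd q" and "card (UNIV :: 'a set) = q ^ 2"
    and "r \<ge> 2"
    and "a \<noteq> 0" and "b \<notin> GF_sub q"
    and "4 * a ^ (q + 1) + (b ^ q - b) ^ 2 = 0"
    and "generates_code r (B_set q r a b) n C"
  shows "n = q ^ (2 * r - 1)
    \<and> code_dim n C = r + 1
    \<and> (r mod 4 = 1 \<or> (odd r \<and> q mod 4 = 1) \<longrightarrow>
      weight_enumerator n C =
        monom 1 0
        + monom (int q ^ 2 - 1) (q ^ (2 * r - 1))
        + monom (int q ^ (r + 2) - int q ^ r)
            (q ^ (2 * r - 1) - q ^ (2 * r - 3)
              - q ^ (3 * (r - 1) div 2) + q ^ ((3 * r - 5) div 2))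
        + monom (int q ^ (2 * r) - int q ^ 2
                   + (int q ^ (2 * r) - int q ^ (r + 1)) * (int q ^ 2 - 1))
            (q ^ (2 * r - 1) - q ^ (2 * r - 3))
        + monom ((int q ^ (r + 1) - int q ^ r) * (int q ^ 2 - 1))
            (q ^ (2 * r - 1) - q ^ (2 * r - 3) + q ^ ((3 * r - 5) div 2)))
    \<and> (r mod 4 = 3 \<and> q mod 4 = 3 \<longrightarrow>
      weight_enumerator n C =
        monom 1 0
        + monom (int q ^ 2 - 1) (q ^ (2 * r - 1))
        + monom ((int q ^ (r + 1) - int q ^ r) * (int q ^ 2 - 1))
            (q ^ (2 * r - 1) - q ^ (2 * r - 3) - q ^ ((3 * r - 5) div 2))
        + monom (int q ^ (2 * r) - int q ^ 2
                   + (int q ^ (2 * r) - int q ^ (r + 1)) * (int q ^ 2 - 1))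
            (q ^ (2 * r - 1) - q ^ (2 * r - 3))
        + monom (int q ^ (r + 2) - int q ^ r)
            (q ^ (2 * r - 1) - q ^ (2 * r - 3)
              + q ^ (3 * (r - 1) div 2) - q ^ ((3 * r - 5) div 2)))
    \<and> (even r \<longrightarrow>
      weight_enumerator n C =
        monom 1 0
        + monom (int q ^ 2 - 1) (q ^ (2 * r - 1))
        + monom ((int q ^ (r + 1) - int q ^ r) * (int q ^ 2 - 1) div 2)
            (q ^ (2 * r - 1) - q ^ (2 * r - 3) + q ^ ((3 * r - 4) div 2))
        + monom ((int q ^ (r + 1) - int q ^ r) * (int q ^ 2 - 1) div 2)
            (q ^ (2 * r - 1) - q ^ (2 * r - 3) - q ^ ((3 * r - 4) div 2))
        + monom (int q ^ (2 * r) + int q ^ (r + 2) - int q ^ r - int q ^ 2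
                   + (int q ^ (2 * r) - int q ^ (r + 1)) * (int q ^ 2 - 1))
            (q ^ (2 * r - 1) - q ^ (2 * r - 3)))
    \<and> card {w. w \<noteq> 0 \<and> weight_count C w \<noteq> 0} = (if r = 2 then 3 else 4)"
proof -
  interpret quasi_hermitian q "TYPE('a)" a b
    using assms by unfold_locales auto
  obtain e1 e2 \<delta> where "basis_like e1 e2 \<delta>"
    using basis_exists by blast
  then interpret quasi_hermitian_basis q "TYPE('a)" a b e1 e2 \<delta>
    by unfold_locales
  show ?thesis
  proof (cases "even r")
    case True
    then obtain k' where "r = 2 * k'"
      by (rule evenE)
    moreover from this have "k' = (k' - 1) + 1"
      using \<open>r \<ge> 2\<close> by simp
    ultimately obtain k where r: "r = 2 * k + 2"
      by (metis distrib_left mult.right_neutral)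
    have gen: "generates_code (2 * k + 2) (B_set q (2 * k + 2) a b) n C"
      using assms(8) unfolding r .
    have exps: "2 * (2 * k + 2) - 1 = 4 * k + 3" "2 * (2 * k + 2) - 3 = 4 * k + 1"
      "(3 * (2 * k + 2) - 4) div 2 = 3 * k + 1"
      "2 * k + 2 + 1 = 2 * k + 3" "2 * k + 2 + 2 = 2 * k + 4"
      by simp_all
    have no: "\<not> ((2 * k + 2) mod 4 = 1 \<or> (odd (2 * k + 2) \<and> q mod 4 = 1))"
      "\<not> ((2 * k + 2) mod 4 = 3 \<and> q mod 4 = 3)"
      by presburger+
    have k0: "2 * k + 2 = 2 \<longleftrightarrow> k = 0"
      by simp
    show ?thesis
      unfolding r exps k0
      by (intro conjI impI enumerator_even[OF gen] card_weights_even[OF gen]) (use no in blast)+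
  next
    case False
    then obtain k' where "r = 2 * k' + 1"
      by (rule oddE)
    moreover from this have "k' = (k' - 1) + 1"
      using \<open>r \<ge> 2\<close> by simp
    ultimately have r': "r = 2 * (k' - 1) + 3"
      by linarith
    define k where "k = k' - 1"
    have r: "r = 2 * k + 3"
      using r' by (simp add: k_def)
    have gen: "generates_code (2 * k + 3) (B_set q (2 * k + 3) a b) n C"
      using assms(8) unfolding r .
    have exps: "2 * (2 * k + 3) - 1 = 4 * k + 5" "2 * (2 * k + 3) - 3 = 4 * k + 3"
      "3 * (2 * k + 3 - 1) div 2 = 3 * k + 3" "(3 * (2 * k + 3) - 5) div 2 = 3 * k + 2"
      "2 * k + 3 + 1 = 2 * k + 4" "2 * k + 3 + 2 = 2 * k + 5"
      by simp_all
    \<comment> \<open>Either \<open>- 1\<close> is a square in \<open>K\<close>, or \<open>r\<close>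
      is 1 modulo 4, which for \<open>r = 2 * k + 3\<close> means that \<open>k + 1\<close> is
      even.\<close>
    have \<epsilon>1: "eta (- 1) ^ (k + 1) = 1"
      if "(2 * k + 3) mod 4 = 1 \<or> (odd (2 * k + 3) \<and> q mod 4 = 1)"
    proof (cases "q mod 4 = 1")
      case False
      then have "odd k"
        using that by presburger
      then show ?thesis
        using chi_q_mod_4 by (simp add: minus_one_power_iff)
    qed (simp add: chi_q_mod_4)
    have \<epsilon>2: "eta (- 1) ^ (k + 1) = - 1" if "(2 * k + 3) mod 4 = 3 \<and> q mod 4 = 3"
    proof -
      have "even k"
        using that by presburger
      then show ?thesis
        using that chi_q_mod_4 by (simp add: minus_one_power_iff)
    qed
    have no: "\<not> even (2 * k + 3)"
      by simp
    have k0: "(if 2 * k + 3 = 2 then 3 else 4) = (4 :: nat)"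
      by simp
    show ?thesis
      unfolding r exps k0
      by (intro conjI impI enumerator_odd[OF gen] card_weights_odd[OF gen] \<epsilon>1 \<epsilon>2) (use no in blast)+
  qed
qed

end
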